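(* Let $R \subset S^2$ be a reduced spherical convex body. If $\Delta(R) < \frac{\pi}{2}$, then $\mathrm{diam}(R) \leq \arccos(\cos^2 \Delta(R))$, and equality $\mathrm{diam}(R) = \arccos(\cos^2 \Delta(R))$ holds if and only if $R$ is a quarter of a disk of radius $\Delta(R)$. If $\Delta(R) \geq \frac{\pi}{2}$, then $\mathrm{diam}(R) = \Delta(R)$.
   Context: $S^2$ is the unit sphere of the Euclidean space $E^3$. A great circle is the intersection of $S^2$ with a two-dimensional linear subspace of $E^3$. A pair of antipodes is the intersection of $S^2$ with a one-dimensional linear subspace. For different points $a,b \in S^2$ which are not antipodes, the arc $ab$ is the shorter part of the unique great circle through $a$ and $b$, and the distance $|ab|$ is the length of the arc $ab$ (with $|aa|=0$). For a set $A \subset S^2$ containing no pair of antipodes, $\mathrm{diam}(A)$ is its diameter with respect to this distance. A subset of $S^2$ is convex if it contains no pair of antipodes and together with every two of its points it contains the arc connecting them. A convex body is a closed convex subset of $S^2$ with non-empty interior; $\mathrm{bd}(C)$ denotes the boundary of $C$. The disk of radius $\rho$ (where $0<\rho\leq\frac{\pi}{2}$) and center $c \in S^2$ is the set of points of $S^2$ at distance at most $\rho$ from $c$. Disks of radius $\frac{\pi}{2}$ are called hemispheres; two hemispheres are opposite if their centers are antipodes. A quarter of a disk is any of the four (closed) parts into which a disk is dissected by two orthogonal great circles through its center. A semicircle with center $p$ is the set of points of a great circle containing $p$ that are at distance at most $\frac{\pi}{2}$ from $p$. If $G, H$ are different non-opposite hemispheres, $L = G\cap H$ is called a lune; it is bounded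 by two semicircles, $G/H$ (the part of the boundary of $L$ lying on the great circle bounding $G$) and $H/G$ (the part lying on the great circle bounding $H$). The thickness $\Delta(L)$ is the distance between the centers of $G/H$ and $H/G$. A hemisphere $K$ supports a convex body $C$ at $p \in \mathrm{bd}(C)$ if $C \subset K$ and $p$ lies on the great circle bounding $K$. For a hemisphere $K$ supporting $C$, $\mathrm{width}_K(C)$ is the minimum of $\Delta(K\cap K^* )$ over all hemispheres $K^*$ supporting $C$ for which $K \cap K^*$ is a lune. The thickness $\Delta(C)$ of $C$ is the minimum of $\mathrm{width}_K(C)$ over all hemispheres $K$ supporting $C$. A convex body $R \subset S^2$ is reduced if $\Delta(Z) < \Delta(R)$ for every convex body $Z \subset R$ different from $R$. *)

theory Defs
  imports "HOL-Analysis.Analysis"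
begin

abbreviation S2 :: "(real^3) set" where
  "S2 \<equiv> sphere 0 1"

text \<open>Boundary and interior are taken relative to the sphere, not in the ambient space.\<close>

definition sbd :: "(real^3) set \<Rightarrow> (real^3) set" where
  "sbd A = top_of_set S2 frontier_of A"

definition sint :: "(real^3) set \<Rightarrow> (real^3) set" where
  "sint A = top_of_set S2 interior_of A"

definition great_circle :: "(real^3) set \<Rightarrow> bool" where
  "great_circle W \<longleftrightarrow> (\<exists>V. subspace V \<and> dim V = 2 \<and> W = S2 \<inter> V)"

text \<open>For unit vectors \<open>a\<close>, \<open>b\<close> that are not antipodes, the shorter part of the great circle
  through them is the part inside the cone they span.  Its length is the angle between them.\<close>

definition sarc :: "real^3 \<Rightarrow> real^3 \<Rightarrow> (real^3) set" where
  "sarc a b = {x \<in> S2. \<exists>s t. 0 \<le> s \<and> 0 \<le> t \<and> x = s *\<^sub>R a + t *\<^sub>R b}"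

definition sdist :: "real^3 \<Rightarrow> real^3 \<Rightarrow> real" where
  "sdist a b = arccos (a \<bullet> b)"

definition sdiam :: "(real^3) set \<Rightarrow> real" where
  "sdiam A = (SUP (a, b) \<in> A \<times> A. sdist a b)"

definition sconvex :: "(real^3) set \<Rightarrow> bool" where
  "sconvex A \<longleftrightarrow> A \<subseteq> S2 \<and> (\<forall>a\<in>A. - a \<notin> A) \<and> (\<forall>a\<in>A. \<forall>b\<in>A. sarc a b \<subseteq> A)"

definition sconvex_body :: "(real^3) set \<Rightarrow> bool" where
  "sconvex_body C \<longleftrightarrow> sconvex C \<and> closed C \<and> sint C \<noteq> {}"

definition sdisk :: "real^3 \<Rightarrow> real \<Rightarrow> (real^3) set" where
  "sdisk c \<rho> = {x \<in> S2. sdist c x \<le> \<rho>}"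

definition hemisphere :: "(real^3) set \<Rightarrow> bool" where
  "hemisphere K \<longleftrightarrow> (\<exists>c\<in>S2. K = sdisk c (pi / 2))"

definition opposite_hemispheres :: "(real^3) set \<Rightarrow> (real^3) set \<Rightarrow> bool" where
  "opposite_hemispheres G H \<longleftrightarrow> (\<exists>c\<in>S2. G = sdisk c (pi / 2) \<and> H = sdisk (- c) (pi / 2))"

text \<open>The great circles through the center \<open>c\<close> are those in the planes with unit normals \<open>u\<close> and \<open>v\<close>;
  they are orthogonal when \<open>u\<close> and \<open>v\<close> are.  Replacing \<open>u\<close> or \<open>v\<close> by its antipode gives the other
  three quarters.\<close>

definition quarter_of_disk :: "real \<Rightarrow> (real^3) set \<Rightarrow> bool" where
  "quarter_of_disk \<rho> Q \<longleftrightarrow> 0 < \<rho> \<and> \<rho> \<le> pi / 2 \<and>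
     (\<exists>c\<in>S2. \<exists>u\<in>S2. \<exists>v\<in>S2. c \<bullet> u = 0 \<and> c \<bullet> v = 0 \<and> u \<bullet> v = 0 \<and>
        Q = {x \<in> sdisk c \<rho>. 0 \<le> x \<bullet> u \<and> 0 \<le> x \<bullet> v})"

definition semicircle_with_center :: "(real^3) set \<Rightarrow> real^3 \<Rightarrow> bool" where
  "semicircle_with_center X p \<longleftrightarrow>
     (\<exists>W. great_circle W \<and> p \<in> W \<and> X = {x \<in> W. sdist p x \<le> pi / 2})"

definition semicircle_center :: "(real^3) set \<Rightarrow> real^3" where
  "semicircle_center X = (THE p. semicircle_with_center X p)"

definition forms_lune :: "(real^3) set \<Rightarrow> (real^3) set \<Rightarrow> bool" where
  "forms_lune G H \<longleftrightarrow> hemisphere G \<and> hemisphere H \<and> G \<noteq> H \<and> \<not> opposite_hemispheres G H"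

text \<open>The bounding semicircle written \<open>G/H\<close> in the literature.\<close>

definition lune_side :: "(real^3) set \<Rightarrow> (real^3) set \<Rightarrow> (real^3) set" where
  "lune_side G H = sbd (G \<inter> H) \<inter> sbd G"

definition lune_thickness :: "(real^3) set \<Rightarrow> (real^3) set \<Rightarrow> real" where
  "lune_thickness G H =
     sdist (semicircle_center (lune_side G H)) (semicircle_center (lune_side H G))"

definition supports_at :: "(real^3) set \<Rightarrow> (real^3) set \<Rightarrow> real^3 \<Rightarrow> bool" where
  "supports_at K C p \<longleftrightarrow> hemisphere K \<and> p \<in> sbd C \<and> C \<subseteq> K \<and> p \<in> sbd K"

definition supports :: "(real^3) set \<Rightarrow> (real^3) set \<Rightarrow> bool" where
  "supports K C \<longleftrightarrow> (\<exists>p. supports_at K C p)"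

text \<open>For a convex body both infima below are over nonempty sets bounded below by 0, and are
  attained, so they are the minima of the usual definition.\<close>

definition swidth :: "(real^3) set \<Rightarrow> (real^3) set \<Rightarrow> real" where
  "swidth K C = (INF K' \<in> {K'. supports K' C \<and> forms_lune K K'}. lune_thickness K K')"

definition thickness :: "(real^3) set \<Rightarrow> real" where
  "thickness C = (INF K \<in> {K. supports K C}. swidth K C)"

definition reduced_body :: "(real^3) set \<Rightarrow> bool" where
  "reduced_body R \<longleftrightarrow> sconvex_body R \<and>
     (\<forall>Z. sconvex_body Z \<and> Z \<subseteq> R \<and> Z \<noteq> R \<longrightarrow> thickness Z < thickness R)"

end

theory Submission
  imports Defs
begin

text \<open>
  A hemisphere containing \<open>C\<close> is given by its center, a point of the dual body
  \<open>C*\<close> of all unit \<open>m\<close> with \<open>m \<bullet> x \<ge> 0\<close> on \<open>C\<close>, and the lune with centers \<open>m, n\<close> has thickness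
  \<open>arccos (- m \<bullet> n)\<close>.  Hence the thickness of \<open>C\<close> is \<open>\<pi>\<close> minus the diameter of \<open>C*\<close>, and \<open>R\<close> is
  reduced iff the diameter of \<open>R*\<close> grows whenever \<open>R*\<close> is enlarged.  Write \<open>c, s\<close> for the cosine
  and sine of the thickness of \<open>R\<close>.  Cutting small caps off \<open>R\<close> shows that \<open>R\<close> is spanned by points
  \<open>e\<close> which are centers of a side of a thinnest lune, i.e. \<open>m \<bullet> e = 0\<close> for some \<open>m \<in> R*\<close> with
  \<open>s e - c m \<in> R*\<close>; the center \<open>c e + s m\<close> of the other side then lies in \<open>R\<close> too.

  If \<open>c > 0\<close>, playing two such lunes off against each other gives \<open>a \<bullet> b \<ge> c\<^sup>2\<close> for any two such
  points.  In the case of equality both opposite centers coincide in a point \<open>p\<close>, all other such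
  points lie within the thickness of \<open>p\<close>, and the quarter of the disk around \<open>p\<close> is filled out.
  If \<open>c \<le> 0\<close>, then \<open>R*\<close> is an intersection of small disks, so every supporting hemisphere belongs
  to a thinnest lune at every point of contact, and a pair with \<open>a \<bullet> b < c\<close> would violate this.
\<close>

subsection \<open>Spherical convexity and duality\<close>

definition sdual :: "(real^3) set \<Rightarrow> (real^3) set" where
  "sdual A = {m \<in> S2. \<forall>x\<in>A. 0 \<le> m \<bullet> x}"

lemma sdualD: "m \<in> sdual A \<Longrightarrow> x \<in> A \<Longrightarrow> 0 \<le> m \<bullet> x"
  by (simp add: sdual_def)

lemma sdual_S2: "m \<in> sdual A \<Longrightarrow> m \<in> S2"
  by (simp add: sdual_def)

lemma S2_inner_self: "x \<in> S2 \<Longrightarrow> x \<bullet> x = 1"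
  by (simp add: dot_square_norm)

lemma S2_I: "x \<bullet> x = 1 \<Longrightarrow> x \<in> S2"
  by (simp add: norm_eq_1)

lemma sgn_S2: "(x::real^3) \<noteq> 0 \<Longrightarrow> sgn x \<in> S2"
  by (simp add: norm_sgn)

lemma inner_sgn_right: "(a::real^3) \<bullet> sgn x = (a \<bullet> x) / norm x"
  by (simp add: sgn_div_norm divide_inverse mult.commute)

lemma inner_sgn_nonneg: "0 \<le> (a::real^3) \<bullet> sgn x \<longleftrightarrow> 0 \<le> a \<bullet> x"
  by (cases "x = 0") (simp_all add: inner_sgn_right zero_le_divide_iff not_le)

lemma inner_sgn_nonneg_left: "0 \<le> sgn x \<bullet> (a::real^3) \<longleftrightarrow> 0 \<le> x \<bullet> a"
  using inner_sgn_nonneg[of a x] by (simp add: inner_commute)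

lemma S2_sgn: "x \<in> S2 \<Longrightarrow> sgn x = x"
  by (simp add: sgn_div_norm)

lemma norm_scaleR_sgn: "norm (x::real^3) *\<^sub>R sgn x = x"
  by (cases "x = 0") (simp_all add: sgn_div_norm)

lemma S2_inner_le_1:
  assumes "x \<in> S2" "y \<in> S2" shows "x \<bullet> y \<le> 1" "-1 \<le> x \<bullet> y"
  using Cauchy_Schwarz_ineq2[of x y] assms by auto

lemma S2_inner_eq_1:
  assumes "x \<in> S2" "y \<in> S2" shows "x \<bullet> y = 1 \<longleftrightarrow> x = y"
proof
  assume "x \<bullet> y = 1"
  then have "(x - y) \<bullet> (x - y) = 0"
    using assms by (simp add: inner_diff_left inner_diff_right S2_inner_self inner_commute)
  then show "x = y" by simp
qed (use assms S2_inner_self in auto)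

lemma S2_inner_eq_minus_1:
  assumes "x \<in> S2" "y \<in> S2" shows "x \<bullet> y = -1 \<longleftrightarrow> x = - y"
  using S2_inner_eq_1[of x "-y"] assms by (auto simp: minus_equation_iff)

text \<open>Up to scaling, a nonnegative combination is a point of the arc from \<open>a\<close> to
  \<open>b\<close>. It cannot vanish: for unit vectors that would force \<open>b = - a\<close>,
  which the absence of antipodes forbids.\<close>

lemma sconvex_comb:
  assumes C: "sconvex C" and a: "a \<in> C" and b: "b \<in> C"
    and st: "0 \<le> s" "0 \<le> t" "0 < s + t"
  shows "s *\<^sub>R a + t *\<^sub>R b \<noteq> 0 \<and> sgn (s *\<^sub>R a + t *\<^sub>R b) \<in> C"
proof -
  have S: "a \<in> S2" "b \<in> S2" using C a b by (auto simp: sconvex_def)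
  have ne: "s *\<^sub>R a + t *\<^sub>R b \<noteq> 0"
  proof
    assume 0: "s *\<^sub>R a + t *\<^sub>R b = 0"
    then have "s *\<^sub>R a = - (t *\<^sub>R b)" by (simp add: eq_neg_iff_add_eq_0)
    then have "norm (s *\<^sub>R a) = norm (t *\<^sub>R b)" by simp
    then have "s = t" using S st by simp
    with 0 st have "s *\<^sub>R (a + b) = 0" "s \<noteq> 0" by (auto simp: scaleR_add_right)
    then have "b = - a" by (simp add: add_eq_0_iff)
    then show False using C a b by (auto simp: sconvex_def)
  qed
  let ?n = "norm (s *\<^sub>R a + t *\<^sub>R b)"
  have "sgn (s *\<^sub>R a + t *\<^sub>R b) = (s / ?n) *\<^sub>R a + (t / ?n) *\<^sub>R b"
    by (simp add: sgn_div_norm scaleR_add_right divide_inverse mult.commute)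
  then have "sgn (s *\<^sub>R a + t *\<^sub>R b) \<in> sarc a b"
    using sgn_S2[OF ne] st unfolding sarc_def
    by (metis (mono_tags, lifting) divide_nonneg_nonneg mem_Collect_eq norm_ge_zero)
  moreover have "sarc a b \<subseteq> C" using C a b by (simp add: sconvex_def)
  ultimately show ?thesis using ne by blast
qed

text \<open>The nonzero vectors whose direction lies in \<open>C\<close> form a convex set
  containing \<open>C\<close>, and hence its hull. That the hull avoids the origin later makes the
  cone over it closed.\<close>

lemma sconvex_convex_hull:
  assumes C: "sconvex C" and p: "p \<in> convex hull C"
  shows "p \<noteq> 0 \<and> sgn p \<in> C"
proof -
  let ?H = "{p. p \<noteq> 0 \<and> sgn p \<in> C}"
  have "convex ?H"
  proof (rule convexI)
    fix x y :: "real^3" and u v :: real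
    assume xy: "x \<in> ?H" "y \<in> ?H" and uv: "0 \<le> u" "0 \<le> v" "u + v = 1"
    have "0 < u * norm x + v * norm y"
      using uv xy by (cases "u = 0") (auto intro: add_pos_nonneg)
    then have "(u * norm x) *\<^sub>R sgn x + (v * norm y) *\<^sub>R sgn y \<noteq> 0 \<and>
      sgn ((u * norm x) *\<^sub>R sgn x + (v * norm y) *\<^sub>R sgn y) \<in> C"
      using xy uv by (intro sconvex_comb[OF C]) auto
    moreover have "(u * norm x) *\<^sub>R sgn x + (v * norm y) *\<^sub>R sgn y = u *\<^sub>R x + v *\<^sub>R y"
      by (metis norm_scaleR_sgn scaleR_scaleR)
    ultimately show "u *\<^sub>R x + v *\<^sub>R y \<in> ?H" by auto
  qed
  moreover have "C \<subseteq> ?H"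
  proof
    fix x assume "x \<in> C"
    moreover have "x \<in> S2" using C \<open>x \<in> C\<close> by (auto simp: sconvex_def)
    ultimately show "x \<in> ?H" using S2_sgn[of x] by auto
  qed
  ultimately show ?thesis using p hull_minimal[of C ?H convex] by blast
qed

text \<open>The cone over a compact convex set avoiding the origin is closed, so a point outside is
  strictly separated from it. The separating normal is nonnegative on \<open>A\<close>, and its
  direction is then a point of the dual with negative product with \<open>n\<close>.\<close>

lemma farkas_sphere:
  assumes A: "compact A" "0 \<notin> convex hull A" and n: "n \<in> sdual (sdual A)"
  shows "\<exists>p\<in>convex hull A. p \<noteq> 0 \<and> n = sgn p"
proof -
  let ?T = "conic hull (convex hull A)"
  have nS: "n \<in> S2" using n sdual_S2 by blast
  have Ane: "A \<noteq> {}"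
  proof
    assume "A = {}"
    then have "- n \<in> sdual A" using nS by (simp add: sdual_def)
    then show False using sdualD[OF n, of "-n"] S2_inner_self[OF nS] by simp
  qed
  have "closed ?T" "convex ?T"
    using A by (auto intro!: closed_conic_hull compact_convex_hull convex_conic_hull)
  have "n \<in> ?T"
  proof (rule ccontr)
    assume "n \<notin> ?T"
    then obtain a b where ab: "a \<bullet> n < b" "\<forall>x\<in>?T. b < a \<bullet> x"
      using separating_hyperplane_closed_point[OF \<open>convex ?T\<close> \<open>closed ?T\<close>] by blast
    have "0 \<in> ?T" using Ane by simp
    then have "b < a \<bullet> 0" using ab by blast
    then have b: "b < 0" by simp
    have pos: "0 \<le> a \<bullet> x" if "x \<in> A" for x
    proof (rule ccontr)
      assume "\<not> 0 \<le> a \<bullet> x"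
      then have neg: "a \<bullet> x < 0" by simp
      \<comment> \<open>This multiple of \<open>x\<close> has product exactly \<open>b\<close> with
        \<open>a\<close>, against strict separation.\<close>
      have "(b / (a \<bullet> x)) *\<^sub>R x \<in> ?T"
        using that b neg by (auto simp: conic_hull_explicit divide_nonpos_neg hull_inc
            intro!: exI[of _ "b / (a \<bullet> x)"] exI[of _ x])
      then have "b < a \<bullet> ((b / (a \<bullet> x)) *\<^sub>R x)" using ab by blast
      then show False using neg by simp
    qed
    have "a \<noteq> 0" using ab b by auto
    then have "sgn a \<in> sdual A"
      using pos by (simp add: sdual_def norm_sgn inner_sgn_nonneg_left)
    then have "0 \<le> n \<bullet> sgn a" using n sdualD by blast
    then have "0 \<le> a \<bullet> n" by (simp add: inner_sgn_nonneg inner_commute)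
    then show False using ab b by simp
  qed
  then obtain t p where tp: "0 \<le> t" "p \<in> convex hull A" "n = t *\<^sub>R p"
    by (auto simp: conic_hull_explicit)
  have "t \<noteq> 0" "p \<noteq> 0" using tp nS by auto
  then have "sgn p = sgn n" using tp by (simp add: sgn_scaleR)
  then show ?thesis using tp \<open>p \<noteq> 0\<close> S2_sgn[OF nS] by auto
qed

lemma sconvex_body_compact: "sconvex_body C \<Longrightarrow> compact C"
  unfolding sconvex_body_def sconvex_def
  by (meson bounded_sphere bounded_subset compact_eq_bounded_closed)

lemma sconvex_body_S2: "sconvex_body C \<Longrightarrow> x \<in> C \<Longrightarrow> x \<in> S2"
  unfolding sconvex_body_def sconvex_def by blast

lemma sconvex_hull_nonzero: "sconvex_body C \<Longrightarrow> 0 \<notin> convex hull C"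
  using sconvex_convex_hull unfolding sconvex_body_def by blast

text \<open>The spherical bipolar theorem: membership in a body can be proved by testing signs
  against its dual.\<close>

lemma sdual_sdual:
  assumes "sconvex_body C" shows "sdual (sdual C) = C"
proof
  show "C \<subseteq> sdual (sdual C)"
    using sconvex_body_S2[OF assms] sdualD[of _ C] by (auto simp: sdual_def inner_commute)
  show "sdual (sdual C) \<subseteq> C"
    using farkas_sphere[OF sconvex_body_compact[OF assms] sconvex_hull_nonzero[OF assms]]
      sconvex_convex_hull[of C] assms unfolding sconvex_body_def by blast
qed

lemma closed_sdual: "closed (sdual A)"
proof -
  have "sdual A = S2 \<inter> (\<Inter>x\<in>A. {m. 0 \<le> m \<bullet> x})" by (auto simp: sdual_def)
  moreover have "closed {m::real^3. 0 \<le> m \<bullet> x}" for x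
    by (intro closed_Collect_le continuous_intros)
  ultimately show ?thesis by (simp add: closed_INT closed_Int)
qed

lemma compact_sdual: "compact (sdual A)"
proof -
  have "sdual A \<subseteq> S2" using sdual_S2 by blast
  then show ?thesis
    using closed_sdual bounded_subset bounded_sphere by (metis compact_eq_bounded_closed)
qed

section \<open>Relative interior and cuts by half-spaces\<close>

lemma sint_iff: "x \<in> sint A \<longleftrightarrow> x \<in> S2 \<and> (\<exists>U. open U \<and> x \<in> U \<and> S2 \<inter> U \<subseteq> A)"
  unfolding sint_def interior_of_def openin_open by blast

lemma sint_subset: "sint A \<subseteq> A" "sint A \<subseteq> S2"
  unfolding subset_iff sint_iff by blast+

lemma sbd_closed:
  assumes "closed A" "A \<subseteq> S2" shows "sbd A = A - sint A"
proof -
  have "closedin (top_of_set S2) A" using assms by (auto simp: closedin_closed)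
  then show ?thesis by (simp add: sbd_def sint_def frontier_of_def closure_of_closedin)
qed

text \<open>From an interior point one can move a little in direction \<open>- d\<close> without
  leaving \<open>A\<close>, so the product with \<open>d\<close> must have room to decrease.\<close>

lemma sint_inner_pos:
  assumes x: "x \<in> sint A" and d: "d \<in> sdual A"
  shows "0 < d \<bullet> x"
proof (rule ccontr)
  assume n: "\<not> 0 < d \<bullet> x"
  obtain U where U: "open U" "x \<in> U" "S2 \<inter> U \<subseteq> A" and xS: "x \<in> S2"
    using x by (auto simp: sint_iff)
  have x0: "x \<noteq> 0" using xS by auto
  have "((\<lambda>h. sgn (x - h *\<^sub>R d)) \<longlongrightarrow> sgn (x - 0 *\<^sub>R d)) (at_right 0)"
    using x0 by (intro tendsto_intros) auto
  then have "((\<lambda>h. sgn (x - h *\<^sub>R d)) \<longlongrightarrow> x) (at_right 0)" using S2_sgn[OF xS] by simp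
  then have "\<forall>\<^sub>F h in at_right 0. sgn (x - h *\<^sub>R d) \<in> U"
    using U topological_tendstoD by blast
  moreover have "\<forall>\<^sub>F h in at_right 0. (0::real) < h" by (simp add: eventually_at_right_less)
  ultimately have "\<forall>\<^sub>F h in at_right (0::real). sgn (x - h *\<^sub>R d) \<in> U \<and> 0 < h"
    by eventually_elim auto
  then obtain h :: real where h: "sgn (x - h *\<^sub>R d) \<in> U" "0 < h"
    using eventually_happens'[OF trivial_limit_at_right_real] by blast
  have dx: "d \<bullet> (x - h *\<^sub>R d) < 0"
    using n h S2_inner_self[OF sdual_S2[OF d]] by (simp add: inner_diff_right)
  then have "x - h *\<^sub>R d \<noteq> 0" by auto
  then have "sgn (x - h *\<^sub>R d) \<in> A" using U h sgn_S2 by blast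
  then have "0 \<le> d \<bullet> sgn (x - h *\<^sub>R d)" using d sdualD by blast
  then show False using dx by (simp add: inner_sgn_nonneg)
qed

text \<open>Adding to \<open>x0\<close> a small multiple of an interior point \<open>i\<close> of
  \<open>C\<close> gives, after normalizing, a point interior to \<open>C\<close> and still strictly
  on the positive side of \<open>z\<close>.\<close>

lemma sint_cut_nonempty:
  assumes C: "sconvex_body C" and x0: "x0 \<in> C" "0 < z \<bullet> x0"
  shows "sint {x\<in>C. 0 \<le> z \<bullet> x} \<noteq> {}"
proof -
  obtain i where i: "i \<in> sint C" using C by (auto simp: sconvex_body_def)
  then obtain U where U: "open U" "i \<in> U" "S2 \<inter> U \<subseteq> C" and iS: "i \<in> S2"
    by (auto simp: sint_iff)
  have iC: "i \<in> C" using i sint_subset by blast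
  have sc: "sconvex C" using C by (simp add: sconvex_body_def)
  have "((\<lambda>h. z \<bullet> (x0 + h *\<^sub>R i)) \<longlongrightarrow> z \<bullet> (x0 + 0 *\<^sub>R i)) (at_right 0)"
    by (intro tendsto_intros)
  then have "\<forall>\<^sub>F h in at_right 0. 0 < z \<bullet> (x0 + h *\<^sub>R i)"
    using x0 order_tendstoD(1) by fastforce
  moreover have "\<forall>\<^sub>F h in at_right 0. (0::real) < h" by (simp add: eventually_at_right_less)
  ultimately have "\<forall>\<^sub>F h in at_right (0::real). 0 < z \<bullet> (x0 + h *\<^sub>R i) \<and> 0 < h"
    by eventually_elim auto
  then obtain h :: real where h: "0 < z \<bullet> (x0 + h *\<^sub>R i)" "0 < h"
    using eventually_happens'[OF trivial_limit_at_right_real] by blast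
  define w where "w = x0 + h *\<^sub>R i"
  have w0: "w \<noteq> 0" using h unfolding w_def by (metis inner_zero_right less_irrefl)
  \<comment> \<open>\<open>f\<close> inverts the mixing:
    \<open>norm w *\<^sub>R y = x0 + h *\<^sub>R f y\<close>. For unit \<open>y\<close> near
    \<open>sgn w\<close> the vector \<open>f y\<close> is near \<open>i\<close>, so its direction is
    in \<open>C\<close>, and therefore \<open>y\<close> is too.\<close>
  define f where "f y = (1/h) *\<^sub>R (norm w *\<^sub>R y - x0)" for y
  have fw: "f (sgn w) = i"
    using w0 h unfolding f_def w_def by (simp add: sgn_div_norm)
  have i0: "i \<noteq> 0" using iS by auto
  have "isCont f (sgn w)" unfolding f_def by (intro continuous_intros)
  then have cf: "(f \<longlongrightarrow> i) (nhds (sgn w))" using fw tendsto_at_iff_tendsto_nhds[of f "sgn w"] by (simp add: isCont_def)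
  have cg: "((\<lambda>y. sgn (f y)) \<longlongrightarrow> sgn i) (nhds (sgn w))"
    using cf i0 by (rule tendsto_sgn)
  have "\<forall>\<^sub>F y in nhds (sgn w). sgn (f y) \<in> U"
    using topological_tendstoD[OF cg U(1)] U(2) S2_sgn[OF iS] by simp
  moreover have "\<forall>\<^sub>F y in nhds (sgn w). f y \<noteq> 0"
    using tendsto_imp_eventually_ne[OF cf i0] .
  moreover have "\<forall>\<^sub>F y in nhds (sgn w). 0 < z \<bullet> y"
  proof -
    have "open {y. 0 < z \<bullet> y}" by (intro open_Collect_less continuous_intros)
    moreover have "0 < z \<bullet> sgn w" using h w0 by (simp add: inner_sgn_right w_def)
    ultimately show ?thesis unfolding eventually_nhds by blast
  qed
  ultimately have "\<forall>\<^sub>F y in nhds (sgn w). sgn (f y) \<in> U \<and> f y \<noteq> 0 \<and> 0 < z \<bullet> y"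
    by eventually_elim auto
  then obtain V where V: "open V" "sgn w \<in> V"
    "\<forall>y\<in>V. sgn (f y) \<in> U \<and> f y \<noteq> 0 \<and> 0 < z \<bullet> y"
    by (auto simp: eventually_nhds)
  have "y \<in> C" if y: "y \<in> V" "y \<in> S2" for y
  proof -
    have g: "sgn (f y) \<in> C" using V y U sgn_S2 by blast
    have "sgn (1 *\<^sub>R x0 + (h * norm (f y)) *\<^sub>R sgn (f y)) \<in> C"
      using sconvex_comb[OF sc x0(1) g, of 1 "h * norm (f y)"] h by (simp add: add_pos_nonneg)
    moreover have "(h * norm (f y)) *\<^sub>R sgn (f y) = norm w *\<^sub>R y - x0"
    proof -
      have "norm (f y) *\<^sub>R sgn (f y) = f y" by (rule norm_scaleR_sgn)
      then have "(h * norm (f y)) *\<^sub>R sgn (f y) = h *\<^sub>R f y" by (metis scaleR_scaleR)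
      then show ?thesis using h unfolding f_def by simp
    qed
    ultimately have "sgn (norm w *\<^sub>R y) \<in> C" by simp
    then show ?thesis using w0 S2_sgn[OF y(2)] by (simp add: sgn_scaleR)
  qed
  then have "S2 \<inter> V \<subseteq> {x\<in>C. 0 \<le> z \<bullet> x}" using V by fastforce
  then have "sgn w \<in> sint {x\<in>C. 0 \<le> z \<bullet> x}"
    using V sgn_S2[OF w0] by (auto simp: sint_iff)
  then show ?thesis by auto
qed

lemma sconvex_body_cut:
  assumes C: "sconvex_body C" and x0: "x0 \<in> C" "0 < z \<bullet> x0"
  shows "sconvex_body {x\<in>C. 0 \<le> z \<bullet> x}"
proof -
  have sc: "sconvex C" "closed C" using C by (auto simp: sconvex_body_def)
  have "closed {x. 0 \<le> z \<bullet> x}" by (intro closed_Collect_le continuous_intros)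
  then have "closed (C \<inter> {x. 0 \<le> z \<bullet> x})" using sc by blast
  moreover have "{x\<in>C. 0 \<le> z \<bullet> x} = C \<inter> {x. 0 \<le> z \<bullet> x}" by blast
  ultimately have cl: "closed {x\<in>C. 0 \<le> z \<bullet> x}" by simp
  have "0 \<le> z \<bullet> x" if "0 \<le> z \<bullet> a" "0 \<le> z \<bullet> b" "x \<in> sarc a b" for a b x
    using that by (auto simp: sarc_def inner_add_right)
  then have "sconvex {x\<in>C. 0 \<le> z \<bullet> x}"
    using sc(1) unfolding sconvex_def by blast
  then show ?thesis using cl sint_cut_nonempty[OF assms] by (simp add: sconvex_body_def)
qed

subsection \<open>Lunes and thickness in terms of the dual body\<close>

lemma orthonormal_expand:
  fixes a b c :: "real^3"
  assumes S: "a \<in> S2" "b \<in> S2" "c \<in> S2" and o: "a \<bullet> b = 0" "a \<bullet> c = 0" "b \<bullet> c = 0"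
  shows "x = (x \<bullet> a) *\<^sub>R a + (x \<bullet> b) *\<^sub>R b + (x \<bullet> c) *\<^sub>R c"
    and "x \<bullet> y = (x \<bullet> a) * (y \<bullet> a) + (x \<bullet> b) * (y \<bullet> b) + (x \<bullet> c) * (y \<bullet> c)"
proof -
  note sq = S[THEN S2_inner_self]
  have ne: "a \<noteq> b" "a \<noteq> c" "b \<noteq> c" using sq o by auto
  have o': "b \<bullet> a = 0" "c \<bullet> a = 0" "c \<bullet> b = 0" using o by (simp_all add: inner_commute)
  have "pairwise orthogonal {a, b, c}"
    using o by (auto simp: pairwise_def orthogonal_def inner_commute)
  moreover have "0 \<notin> {a, b, c}" using S by auto
  ultimately have ind: "independent {a, b, c}" by (rule pairwise_orthogonal_independent)
  have card: "card {a, b, c} = 3" using ne by simp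
  have "(UNIV :: (real^3) set) \<subseteq> span {a, b, c}"
    by (rule card_ge_dim_independent[OF _ ind]) (simp_all add: card dim_UNIV)
  then have sp: "z \<in> span {a, b, c}" for z by blast
  let ?y = "x - ((x \<bullet> a) *\<^sub>R a + (x \<bullet> b) *\<^sub>R b + (x \<bullet> c) *\<^sub>R c)"
  have "?y \<bullet> ?y = 0"
  proof -
    have "orthogonal ?y ?y"
    proof (rule orthogonal_to_span[OF sp])
      fix z assume "z \<in> {a, b, c}"
      then show "orthogonal ?y z"
        using sq o o' by (auto simp: orthogonal_def inner_diff_left inner_add_left)
    qed
    then show ?thesis by (simp add: orthogonal_def)
  qed
  then show e: "x = (x \<bullet> a) *\<^sub>R a + (x \<bullet> b) *\<^sub>R b + (x \<bullet> c) *\<^sub>R c" by simp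
  have "x \<bullet> y = ((x \<bullet> a) *\<^sub>R a + (x \<bullet> b) *\<^sub>R b + (x \<bullet> c) *\<^sub>R c) \<bullet> y" using e by simp
  then show "x \<bullet> y = (x \<bullet> a) * (y \<bullet> a) + (x \<bullet> b) * (y \<bullet> b) + (x \<bullet> c) * (y \<bullet> c)"
    by (simp add: inner_add_left inner_add_right inner_commute)
qed

lemma cross3_frame:
  fixes a b :: "real^3"
  assumes "a \<in> S2" "b \<in> S2" "a \<bullet> b = 0"
  shows "cross3 a b \<in> S2" "a \<bullet> cross3 a b = 0" "b \<bullet> cross3 a b = 0"
proof -
  have "(norm (cross3 a b))\<^sup>2 = 1" using assms by (simp add: norm_cross)
  then show "cross3 a b \<in> S2" by (simp add: power2_eq_1_iff norm_ge_zero)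
    (metis neg_0_le_iff_le norm_ge_zero not_one_le_zero)
qed (simp_all add: dot_cross_self)

lemma S2_abs_inner:
  assumes "x \<in> S2" "y \<in> S2" shows "\<bar>x \<bullet> y\<bar> \<le> 1"
  using S2_inner_le_1[OF assms] by (simp add: abs_le_iff)

lemma sdisk_eq:
  assumes c: "c \<in> S2" and r: "0 \<le> r" "r \<le> pi"
  shows "sdisk c r = {x \<in> S2. cos r \<le> c \<bullet> x}"
proof -
  have "sdist c x \<le> r \<longleftrightarrow> cos r \<le> c \<bullet> x" if "x \<in> S2" for x
  proof -
    have "arccos (c \<bullet> x) \<le> arccos (cos r) \<longleftrightarrow> cos r \<le> c \<bullet> x"
      using S2_abs_inner[OF c that] by (intro arccos_le_mono) (simp_all add: abs_cos_le_one)
    then show ?thesis using r by (simp add: sdist_def arccos_cos)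
  qed
  then show ?thesis by (auto simp: sdisk_def)
qed

section \<open>Hemispheres, lunes and the centers of their sides\<close>

definition hemi :: "real^3 \<Rightarrow> (real^3) set" where
  "hemi m = {x \<in> S2. 0 \<le> m \<bullet> x}"

lemma sdisk_hemi: "m \<in> S2 \<Longrightarrow> sdisk m (pi / 2) = hemi m"
  using sdisk_eq[of m "pi/2"] by (simp add: hemi_def)

lemma hemisphere_iff: "hemisphere K \<longleftrightarrow> (\<exists>m\<in>S2. K = hemi m)"
  unfolding hemisphere_def by (metis sdisk_hemi)

text \<open>The direction of \<open>m - n\<close> has positive product with \<open>m\<close> and
  negative product with \<open>n\<close>, so it tells the hemispheres apart.\<close>

lemma hemi_inject:
  assumes m: "m \<in> S2" and n: "n \<in> S2" and e: "hemi m = hemi n" shows "m = n"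
proof (rule ccontr)
  assume ne: "m \<noteq> n"
  have lt: "m \<bullet> n < 1"
    using S2_inner_le_1(1)[OF m n] S2_inner_eq_1[OF m n] ne by (simp add: less_le)
  let ?x = "sgn (m - n)"
  have "?x \<in> S2" using ne sgn_S2 by simp
  moreover have "0 \<le> m \<bullet> ?x"
    using lt S2_inner_self[OF m] by (simp add: inner_sgn_nonneg inner_diff_right)
  moreover have "\<not> 0 \<le> n \<bullet> ?x"
    using lt S2_inner_self[OF n] by (simp add: inner_sgn_nonneg inner_diff_right inner_commute)
  ultimately show False using e unfolding hemi_def by blast
qed

lemma minus_S2: "m \<in> S2 \<Longrightarrow> - m \<in> S2"
  by simp

lemma forms_lune_hemi:
  assumes m: "m \<in> S2" and n: "n \<in> S2"
  shows "forms_lune (hemi m) (hemi n) \<longleftrightarrow> m \<noteq> n \<and> m \<noteq> - n"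
proof -
  have "opposite_hemispheres (hemi m) (hemi n) \<longleftrightarrow> m = - n"
  proof
    assume "opposite_hemispheres (hemi m) (hemi n)"
    then obtain c where c: "c \<in> S2" "hemi m = hemi c" "hemi n = hemi (- c)"
      unfolding opposite_hemispheres_def using sdisk_hemi minus_S2 by metis
    then have "m = c" "n = - c" using hemi_inject m n minus_S2 by blast+
    then show "m = - n" by simp
  next
    assume "m = - n"
    then have "n = - m" by simp
    then show "opposite_hemispheres (hemi m) (hemi n)"
      unfolding opposite_hemispheres_def
      using m sdisk_hemi[OF m] sdisk_hemi[OF minus_S2[OF m]] by blast
  qed
  moreover have "hemi m = hemi n \<longleftrightarrow> m = n" using hemi_inject m n by blast
  moreover have "hemisphere (hemi m)" "hemisphere (hemi n)" using m n hemisphere_iff by auto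
  ultimately show ?thesis by (auto simp: forms_lune_def)
qed

text \<open>The interior of the intersection is where both products are positive. The case
  \<open>m = n\<close> is included and yields the boundary of a single hemisphere in
  \<open>sbd_hemi\<close>.\<close>

lemma sbd_lune:
  assumes m: "m \<in> S2" and n: "n \<in> S2"
  shows "sbd (hemi m \<inter> hemi n) =
    {x \<in> S2. 0 \<le> m \<bullet> x \<and> 0 \<le> n \<bullet> x \<and> (m \<bullet> x = 0 \<or> n \<bullet> x = 0)}"
proof -
  let ?A = "hemi m \<inter> hemi n"
  have A: "?A = S2 \<inter> {x. 0 \<le> m \<bullet> x} \<inter> {x. 0 \<le> n \<bullet> x}" by (auto simp: hemi_def)
  have "closed {x. 0 \<le> m \<bullet> x}" "closed {x. 0 \<le> n \<bullet> x}"
    by (intro closed_Collect_le continuous_intros)+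
  then have "closed ?A" unfolding A by (intro closed_Int closed_sphere)
  then have 1: "sbd ?A = ?A - sint ?A" using sbd_closed[of ?A] A by blast
  have "m \<in> sdual ?A" "n \<in> sdual ?A" using m n by (auto simp: sdual_def hemi_def)
  then have 2: "0 < m \<bullet> x \<and> 0 < n \<bullet> x" if "x \<in> sint ?A" for x
    using sint_inner_pos that by blast
  have 3: "x \<in> sint ?A" if "x \<in> S2" "0 < m \<bullet> x" "0 < n \<bullet> x" for x
  proof -
    let ?U = "{x. 0 < m \<bullet> x} \<inter> {x. 0 < n \<bullet> x}"
    have "open ?U" by (intro open_Int open_Collect_less continuous_intros)
    moreover have "S2 \<inter> ?U \<subseteq> ?A" by (auto simp: hemi_def)
    moreover have "x \<in> ?U" using that by simp
    ultimately show ?thesis using that(1) unfolding sint_iff by metis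
  qed
  have 4: "x \<in> sint ?A \<longleftrightarrow> x \<in> S2 \<and> 0 < m \<bullet> x \<and> 0 < n \<bullet> x" for x
    using 2 3 sint_subset(2) by blast
  have 5: "x \<in> ?A \<longleftrightarrow> x \<in> S2 \<and> 0 \<le> m \<bullet> x \<and> 0 \<le> n \<bullet> x" for x
    unfolding hemi_def by blast
  show ?thesis
  proof (rule set_eqI)
    fix x
    have "(0 \<le> m \<bullet> x \<and> 0 \<le> n \<bullet> x) \<and> \<not> (0 < m \<bullet> x \<and> 0 < n \<bullet> x) \<longleftrightarrow>
      0 \<le> m \<bullet> x \<and> 0 \<le> n \<bullet> x \<and> (m \<bullet> x = 0 \<or> n \<bullet> x = 0)" by auto
    then show "x \<in> sbd ?A \<longleftrightarrow> x \<in> {x \<in> S2. 0 \<le> m \<bullet> x \<and> 0 \<le> n \<bullet> x \<and> (m \<bullet> x = 0 \<or> n \<bullet> x = 0)}"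
      unfolding 1 Diff_iff 4 5 mem_Collect_eq by argo
  qed
qed

lemma sbd_hemi: "m \<in> S2 \<Longrightarrow> sbd (hemi m) = {x \<in> S2. m \<bullet> x = 0}"
proof -
  assume m: "m \<in> S2"
  have "0 \<le> t \<and> 0 \<le> t \<and> (t = 0 \<or> t = 0) \<longleftrightarrow> t = 0" for t :: real by auto
  then show ?thesis using sbd_lune[OF m m] by (simp only: Int_absorb)
qed

lemma lune_side_hemi:
  assumes "m \<in> S2" "n \<in> S2"
  shows "lune_side (hemi m) (hemi n) = {x \<in> S2. m \<bullet> x = 0 \<and> 0 \<le> n \<bullet> x}"
proof -
  have "(P \<and> 0 \<le> t \<and> 0 \<le> u \<and> (t = 0 \<or> u = 0)) \<and> P \<and> t = 0 \<longleftrightarrow> P \<and> t = 0 \<and> 0 \<le> u"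
    for P and t u :: real by auto
  then show ?thesis
    unfolding lune_side_def sbd_lune[OF assms] sbd_hemi[OF assms(1)] Collect_conj_eq[symmetric]
    by (simp only: )
qed

text \<open>The center is a definite description, so uniqueness is the point. The ends
  \<open>w\<close> and \<open>- w\<close> of the semicircle are within a right angle of any center
  \<open>q\<close>, so \<open>q\<close> is orthogonal to \<open>w\<close> in the plane of the
  circle. Only \<open>p\<close> and \<open>- p\<close> remain, and \<open>p\<close> itself lies in
  the set.\<close>

lemma semicircle_center_eq:
  assumes m: "m \<in> S2" and p: "p \<in> S2" and mp: "m \<bullet> p = 0"
  shows "semicircle_center {x \<in> S2. m \<bullet> x = 0 \<and> 0 \<le> p \<bullet> x} = p"
proof -
  let ?X = "{x \<in> S2. m \<bullet> x = 0 \<and> 0 \<le> p \<bullet> x}"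
  have disk: "sdist q x \<le> pi / 2 \<longleftrightarrow> 0 \<le> q \<bullet> x" if "q \<in> S2" "x \<in> S2" for q x
    using sdisk_hemi[OF that(1)] that(2) by (auto simp: sdisk_def hemi_def)
  have "semicircle_with_center ?X p"
  proof -
    have "m \<noteq> 0" using m by auto
    then have "great_circle (S2 \<inter> {x. m \<bullet> x = 0})"
      unfolding great_circle_def using subspace_hyperplane dim_hyperplane[of m] by fastforce
    moreover have "p \<in> S2 \<inter> {x. m \<bullet> x = 0}" using p mp by simp
    moreover have "?X = {x \<in> S2 \<inter> {x. m \<bullet> x = 0}. sdist p x \<le> pi / 2}" using disk[OF p] by auto
    ultimately show ?thesis unfolding semicircle_with_center_def by blast
  qed
  moreover have "q = p" if q: "semicircle_with_center ?X q" for q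
  proof -
    obtain V where V: "subspace V" "dim V = 2" and qV: "q \<in> S2" "q \<in> V"
      and X: "?X = {x \<in> S2 \<inter> V. sdist q x \<le> pi / 2}"
      using q unfolding semicircle_with_center_def great_circle_def by blast
    have Xq: "x \<in> V \<and> 0 \<le> q \<bullet> x" if "x \<in> ?X" for x
    proof -
      have "x \<in> S2" using that by blast
      have "x \<in> {x \<in> S2 \<inter> V. sdist q x \<le> pi / 2}" using that X by blast
      then show ?thesis using disk[OF qV(1) \<open>x \<in> S2\<close>] by blast
    qed
    define w where "w = cross3 m p"
    have w: "w \<in> S2" "m \<bullet> w = 0" "p \<bullet> w = 0" using cross3_frame[OF m p mp] by (auto simp: w_def)
    have pX: "p \<in> ?X" using p mp by (simp add: S2_inner_self)
    have "w \<in> ?X" "- w \<in> ?X" using w by auto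
    then have wV: "w \<in> V" "q \<bullet> w = 0" using Xq[of w] Xq[of "-w"] by auto
    have pV: "p \<in> V" "0 \<le> q \<bullet> p" using Xq[OF pX] by auto
    have ne: "p \<noteq> w" using w S2_inner_self[OF p] by auto
    have "independent {p, w}"
      using w p by (intro pairwise_orthogonal_independent)
        (auto simp: pairwise_def orthogonal_def inner_commute)
    then have "V \<subseteq> span {p, w}"
      using V pV wV ne by (intro card_ge_dim_independent) auto
    then have "q \<in> span {p, w}" using qV by blast
    then obtain s t where st: "q = s *\<^sub>R p + t *\<^sub>R w"
      by (auto simp: span_breakdown_eq) (metis add_diff_cancel_left' diff_add_cancel)
    have "t = 0" using wV(2) w S2_inner_self[OF w(1)] by (simp add: st inner_add_left)
    moreover have "0 \<le> s" using pV(2) w S2_inner_self[OF p] by (simp add: st inner_add_right inner_add_left inner_commute)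
    moreover have "\<bar>s\<bar> = 1" using qV(1) p \<open>t = 0\<close> by (simp add: st)
    ultimately show ?thesis using st by simp
  qed
  ultimately show ?thesis unfolding semicircle_center_def by (rule the_equality)
qed

lemma norm_orth_part:
  assumes m: "m \<in> S2" and n: "n \<in> S2"
  shows "(n - (m \<bullet> n) *\<^sub>R m) \<bullet> (n - (m \<bullet> n) *\<^sub>R m) = 1 - (m \<bullet> n)\<^sup>2"
  using S2_inner_self[OF m] S2_inner_self[OF n]
  by (simp add: inner_diff_left inner_diff_right inner_commute power2_eq_square)

text \<open>On the great circle orthogonal to \<open>m\<close>, the products with \<open>n\<close>
  and with the projection of \<open>n\<close> agree, so the side is centered at the normalized
  projection.\<close>

lemma lune_center:
  assumes m: "m \<in> S2" and n: "n \<in> S2" and ne: "m \<noteq> n" "m \<noteq> - n"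
  shows "semicircle_center (lune_side (hemi m) (hemi n)) = sgn (n - (m \<bullet> n) *\<^sub>R m)"
    and "norm (n - (m \<bullet> n) *\<^sub>R m) = sqrt (1 - (m \<bullet> n)\<^sup>2)"
    and "0 < 1 - (m \<bullet> n)\<^sup>2"
proof -
  let ?v = "n - (m \<bullet> n) *\<^sub>R m"
  show nv: "norm ?v = sqrt (1 - (m \<bullet> n)\<^sup>2)"
    using norm_orth_part[OF m n] by (simp add: norm_eq_sqrt_inner)
  have "m \<bullet> n < 1" "-1 < m \<bullet> n"
    using S2_inner_le_1[OF m n] S2_inner_eq_1[OF m n] S2_inner_eq_minus_1[OF m n] ne
    by (auto simp: less_le)
  then show pos: "0 < 1 - (m \<bullet> n)\<^sup>2"
    by (simp add: abs_square_less_1)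
  then have v0: "?v \<noteq> 0" using nv by (metis norm_zero real_sqrt_gt_zero less_irrefl)
  have mv: "m \<bullet> ?v = 0" using S2_inner_self[OF m] by (simp add: inner_diff_right)
  have "{x \<in> S2. m \<bullet> x = 0 \<and> 0 \<le> n \<bullet> x} = {x \<in> S2. m \<bullet> x = 0 \<and> 0 \<le> sgn ?v \<bullet> x}"
  proof -
    have "0 \<le> sgn ?v \<bullet> x \<longleftrightarrow> 0 \<le> n \<bullet> x" if "m \<bullet> x = 0" for x
      using that by (simp add: inner_sgn_nonneg_left inner_diff_left)
    then show ?thesis by blast
  qed
  moreover have "m \<bullet> sgn ?v = 0" using mv by (simp add: inner_sgn_right)
  ultimately show "semicircle_center (lune_side (hemi m) (hemi n)) = sgn ?v"
    using semicircle_center_eq[OF m sgn_S2[OF v0]] lune_side_hemi[OF m n] by simp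
qed

text \<open>With \<open>k = m \<bullet> n\<close>, the two projections have product
  \<open>- k * (1 - k\<^sup>2)\<close> and common norm \<open>sqrt (1 - k\<^sup>2)\<close>, so the
  cosine of the angle between the side centers is \<open>- k\<close>.\<close>

lemma lune_thickness_hemi:
  assumes m: "m \<in> S2" and n: "n \<in> S2" and ne: "m \<noteq> n" "m \<noteq> - n"
  shows "lune_thickness (hemi m) (hemi n) = arccos (- (m \<bullet> n))"
proof -
  have ne': "n \<noteq> m" "n \<noteq> - m" using ne by auto
  let ?k = "m \<bullet> n"
  note c1 = lune_center[OF m n ne]
  have c2: "semicircle_center (lune_side (hemi n) (hemi m)) = sgn (m - ?k *\<^sub>R n)"
    "norm (m - ?k *\<^sub>R n) = sqrt (1 - ?k\<^sup>2)"
    using lune_center[OF n m ne'] by (simp_all add: inner_commute)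
  have i: "(n - ?k *\<^sub>R m) \<bullet> (m - ?k *\<^sub>R n) = - ?k * (1 - ?k\<^sup>2)"
    using S2_inner_self[OF m] S2_inner_self[OF n]
    by (simp add: inner_diff_left inner_diff_right inner_commute power2_eq_square algebra_simps)
  have "sgn (n - ?k *\<^sub>R m) \<bullet> sgn (m - ?k *\<^sub>R n)
      = ((n - ?k *\<^sub>R m) \<bullet> (m - ?k *\<^sub>R n)) / (norm (n - ?k *\<^sub>R m) * norm (m - ?k *\<^sub>R n))"
    by (simp add: sgn_div_norm divide_inverse)
  also have "\<dots> = ((n - ?k *\<^sub>R m) \<bullet> (m - ?k *\<^sub>R n)) / (sqrt (1 - ?k\<^sup>2) * sqrt (1 - ?k\<^sup>2))"
    unfolding c1(2) c2(2) ..
  also have "\<dots> = - ?k" using i c1(3) by simp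
  finally show ?thesis using c1(1) c2(1) by (simp add: lune_thickness_def sdist_def)
qed

lemma sdual_comb:
  assumes "m \<in> sdual C" "n \<in> sdual C" "0 \<le> s" "0 \<le> t" "s *\<^sub>R m + t *\<^sub>R n \<noteq> 0"
  shows "sgn (s *\<^sub>R m + t *\<^sub>R n) \<in> sdual C"
  using assms sgn_S2[OF assms(5)]
  by (auto simp: sdual_def inner_sgn_nonneg_left inner_add_left simp del: mem_sphere_0)

text \<open>First-order condition: moving from the minimizer towards \<open>z\<close> cannot decrease the inner
  product with \<open>m\<close>.\<close>

lemma sdual_minimizer_center:
  assumes n: "n \<in> sdual C" and mS: "m \<in> S2" and min: "\<And>z. z \<in> sdual C \<Longrightarrow> m \<bullet> n \<le> m \<bullet> z"
    and z: "z \<in> sdual C"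
  shows "0 \<le> (m - (m \<bullet> n) *\<^sub>R n) \<bullet> z"
proof (rule ccontr)
  assume neg: "\<not> ?thesis"
  let ?k = "m \<bullet> n" and ?a = "m \<bullet> z" and ?b = "n \<bullet> z"
  have nS: "n \<in> S2" and zS: "z \<in> S2" using n z sdual_S2 by blast+
  \<comment> \<open>\<open>?f h\<close> is the product of \<open>m\<close> with
    \<open>n + h *\<^sub>R z\<close>, minus \<open>?k\<close> times the norm of that vector.
    Minimality keeps it nonnegative for small \<open>h > 0\<close> and it vanishes at 0, so its
    derivative there cannot be negative.\<close>
  let ?f = "\<lambda>h. ?k + h * ?a - ?k * sqrt (1 + 2 * h * ?b + h\<^sup>2)"
  have "DERIV ?f 0 :> ?a - ?k * ?b"
    by (auto intro!: derivative_eq_intros)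
  moreover have "?a - ?k * ?b < 0" using neg by (simp add: inner_diff_left)
  ultimately have "\<exists>d>0. \<forall>h>0. h < d \<longrightarrow> ?f 0 > ?f (0 + h)"
    by (rule DERIV_neg_dec_right)
  then obtain d where d: "d > 0" "\<And>h. h > 0 \<Longrightarrow> h < d \<Longrightarrow> ?f (0 + h) < ?f 0"
    by blast
  define h where "h = min (d/2) (1/2)"
  have h: "0 < h" "h < d" "h < 1" using d by (auto simp: h_def)
  let ?w = "1 *\<^sub>R n + h *\<^sub>R z"
  have w0: "?w \<noteq> 0"
  proof
    assume "?w = 0"
    then have "n = - (h *\<^sub>R z)" by (simp add: eq_neg_iff_add_eq_0)
    then have "norm n = h" using h zS by simp
    then show False using nS h by simp
  qed
  have nw: "norm ?w = sqrt (1 + 2 * h * ?b + h\<^sup>2)"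
    using S2_inner_self[OF nS] S2_inner_self[OF zS]
    by (simp add: norm_eq_sqrt_inner inner_add_left inner_add_right inner_commute power2_eq_square)
  have "sgn ?w \<in> sdual C" using sdual_comb[OF n z _ _ w0] h by simp
  then have "?k \<le> m \<bullet> sgn ?w" by (rule min)
  then have "?k * norm ?w \<le> m \<bullet> ?w" using w0 by (simp add: inner_sgn_right pos_le_divide_eq)
  moreover have "m \<bullet> ?w = ?k + h * ?a" by (simp add: inner_add_right)
  ultimately have "0 \<le> ?f h" using nw by simp
  moreover have "?f 0 = 0" by simp
  ultimately show False using d(2)[OF h(1,2)] by simp
qed

lemma sconvex_body_interior_point:
  assumes "sconvex_body C"
  obtains i where "i \<in> C" "\<And>m. m \<in> sdual C \<Longrightarrow> 0 < m \<bullet> i"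
  using assms sint_inner_pos sint_subset unfolding sconvex_body_def by blast

lemma sdual_not_antipodal:
  assumes "sconvex_body C" "m \<in> sdual C" "n \<in> sdual C" shows "m \<noteq> - n"
proof -
  obtain i where "0 < m \<bullet> i" "0 < n \<bullet> i" using sconvex_body_interior_point assms by metis
  then show ?thesis by auto
qed

text \<open>If the dual had at most the one point \<open>m\<close>, a unit vector orthogonal to
  \<open>m\<close> and its negative would both be in the bidual, which is \<open>C\<close> and has
  no antipodes.\<close>

lemma sdual_two_elements:
  assumes C: "sconvex_body C"
  shows "sdual C \<noteq> {}" "m \<in> S2 \<Longrightarrow> \<exists>n\<in>sdual C. n \<noteq> m"
proof -
  have *: False if sub: "sdual C \<subseteq> {m}" and m: "m \<in> S2" for m
  proof -
    obtain y where y: "y \<noteq> 0" "orthogonal m y"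
      using orthogonal_to_vector_exists[of m] by auto
    then have "sgn y \<in> sdual (sdual C)" "- sgn y \<in> sdual (sdual C)"
      using sub sgn_S2[OF y(1)]
      by (auto simp: sdual_def inner_sgn_nonneg_left orthogonal_def inner_commute inner_sgn_right)
    then have "sgn y \<in> C" "- sgn y \<in> C" using sdual_sdual[OF C] by auto
    then show False using C by (auto simp: sconvex_body_def sconvex_def)
  qed
  show "\<exists>n\<in>sdual C. n \<noteq> m" if "m \<in> S2" using *[OF _ that] by blast
  show "sdual C \<noteq> {}" using *[of "axis 1 1"] by auto
qed

text \<open>By the first-order condition the projection of \<open>m\<close> is nonnegative on the
  dual. The bipolar theorem then puts its direction, the center of the side on the circle bounding
  \<open>hemi n\<close>, into \<open>C\<close>.\<close>

lemma minimizer_center_mem: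
  assumes C: "sconvex_body C" and n: "n \<in> sdual C" and mS: "m \<in> S2"
    and min: "\<And>z. z \<in> sdual C \<Longrightarrow> m \<bullet> n \<le> m \<bullet> z" and ne: "m \<noteq> n" "m \<noteq> - n"
  shows "sgn (m - (m \<bullet> n) *\<^sub>R n) \<in> C"
proof -
  have nS: "n \<in> S2" using n sdual_S2 by blast
  have "norm (m - (n \<bullet> m) *\<^sub>R n) = sqrt (1 - (n \<bullet> m)\<^sup>2)" "0 < 1 - (n \<bullet> m)\<^sup>2"
    using lune_center[OF nS mS] ne by (metis minus_minus)+
  then have "m - (m \<bullet> n) *\<^sub>R n \<noteq> 0"
    by (metis inner_commute less_irrefl norm_zero real_sqrt_gt_zero)
  then have "sgn (m - (m \<bullet> n) *\<^sub>R n) \<in> sdual (sdual C)"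
    using sgn_S2 sdual_minimizer_center[OF n mS min]
    by (auto simp: sdual_def inner_sgn_nonneg_left simp del: mem_sphere_0)
  then show ?thesis using sdual_sdual[OF C] by simp
qed

section \<open>Width and thickness as extremal inner products over the dual\<close>

lemma supports_hemi:
  assumes C: "sconvex_body C" and m: "m \<in> S2"
  shows "supports (hemi m) C \<longleftrightarrow> m \<in> sdual C \<and> (\<exists>p\<in>C. m \<bullet> p = 0)"
proof
  have cl: "closed C" "C \<subseteq> S2" using C by (auto simp: sconvex_body_def sconvex_def)
  {
    assume "supports (hemi m) C"
    then obtain p where p: "p \<in> sbd C" "C \<subseteq> hemi m" "p \<in> sbd (hemi m)"
      by (auto simp: supports_def supports_at_def)
    then show "m \<in> sdual C \<and> (\<exists>p\<in>C. m \<bullet> p = 0)"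
      using m sbd_closed[OF cl] sbd_hemi[OF m] by (auto simp: sdual_def hemi_def)
  next
    assume r: "m \<in> sdual C \<and> (\<exists>p\<in>C. m \<bullet> p = 0)"
    then obtain p where p: "p \<in> C" "m \<bullet> p = 0" by blast
    then have "p \<in> sbd C" using sint_inner_pos[of p C m] r sbd_closed[OF cl] by auto
    moreover have "p \<in> sbd (hemi m)" using p cl sbd_hemi[OF m] by auto
    moreover have "C \<subseteq> hemi m" using r cl by (auto simp: sdual_def hemi_def)
    ultimately show "supports (hemi m) C"
      unfolding supports_def supports_at_def using m hemisphere_iff by blast
  }
qed

lemma sdual_minimizer_exists:
  assumes C: "sconvex_body C" shows "\<exists>n\<in>sdual C. \<forall>z\<in>sdual C. m \<bullet> n \<le> m \<bullet> z"
  by (intro continuous_attains_inf compact_sdual sdual_two_elements(1)[OF C] continuous_intros)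

text \<open>A minimizer over the whole dual automatically gives a supporting hemisphere that forms a
  lune with \<open>hemi m\<close>. Hence the infimum defining \<open>swidth\<close> can be evaluated
  over all of \<open>sdual C\<close>.\<close>

lemma minimizer_supports:
  assumes C: "sconvex_body C" and m: "m \<in> sdual C" and n: "n \<in> sdual C"
    and min: "\<And>z. z \<in> sdual C \<Longrightarrow> m \<bullet> n \<le> m \<bullet> z"
  shows "m \<noteq> n" "m \<noteq> - n" "supports (hemi n) C"
proof -
  have S: "m \<in> S2" "n \<in> S2" using m n sdual_S2 by blast+
  show ne: "m \<noteq> n"
  proof
    assume e: "m = n"
    obtain n' where n': "n' \<in> sdual C" "n' \<noteq> m" using sdual_two_elements(2)[OF C S(1)] by blast
    then have "1 \<le> m \<bullet> n'" using min[OF n'(1)] e S2_inner_self[OF S(1)] by simp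
    then show False
      using n' S2_inner_le_1(1)[OF S(1) sdual_S2[OF n'(1)]] S2_inner_eq_1[OF S(1) sdual_S2[OF n'(1)]]
      by auto
  qed
  show ne': "m \<noteq> - n" using sdual_not_antipodal[OF C m n] .
  have "sgn (m - (m \<bullet> n) *\<^sub>R n) \<in> C" by (rule minimizer_center_mem[OF C n S(1) min ne ne'])
  moreover have "n \<bullet> sgn (m - (m \<bullet> n) *\<^sub>R n) = 0"
    using S2_inner_self[OF S(2)] by (simp add: inner_sgn_right inner_diff_right inner_commute)
  ultimately show "supports (hemi n) C" using supports_hemi[OF C S(2)] n by blast
qed

lemma swidth_eq:
  assumes C: "sconvex_body C" and m: "m \<in> sdual C" and n: "n \<in> sdual C"
    and min: "\<And>z. z \<in> sdual C \<Longrightarrow> m \<bullet> n \<le> m \<bullet> z"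
  shows "swidth (hemi m) C = arccos (- (m \<bullet> n))"
  unfolding swidth_def
proof (rule cInf_eq_minimum)
  have S: "m \<in> S2" "n \<in> S2" using m n sdual_S2 by blast+
  note k = minimizer_supports[OF C m n min]
  have "lune_thickness (hemi m) (hemi n) = arccos (- (m \<bullet> n))"
    by (rule lune_thickness_hemi[OF S k(1,2)])
  moreover have "forms_lune (hemi m) (hemi n)" using forms_lune_hemi[OF S] k by simp
  ultimately show "arccos (- (m \<bullet> n)) \<in>
      lune_thickness (hemi m) ` {K'. supports K' C \<and> forms_lune (hemi m) K'}"
    using k(3) by (metis (mono_tags, lifting) image_eqI mem_Collect_eq)
  fix x assume "x \<in> lune_thickness (hemi m) ` {K'. supports K' C \<and> forms_lune (hemi m) K'}"
  then obtain K where K: "supports K C" "forms_lune (hemi m) K" "x = lune_thickness (hemi m) K"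
    by blast
  then obtain z where z: "z \<in> S2" "K = hemi z"
    unfolding supports_def supports_at_def hemisphere_iff by blast
  have zd: "z \<in> sdual C" using supports_hemi[OF C z(1)] K z by simp
  have "m \<noteq> z" "m \<noteq> - z" using K z forms_lune_hemi[OF S(1) z(1)] by auto
  then have "x = arccos (- (m \<bullet> z))" using lune_thickness_hemi[OF S(1) z(1)] K z by simp
  moreover have "arccos (- (m \<bullet> n)) \<le> arccos (- (m \<bullet> z))"
    using min[OF zd] S2_abs_inner[OF S] S2_abs_inner[OF S(1) z(1)] by (subst arccos_le_mono) auto
  ultimately show "arccos (- (m \<bullet> n)) \<le> x" by simp
qed

lemma thickness_eq:
  assumes C: "sconvex_body C" and m: "m \<in> sdual C" and n: "n \<in> sdual C"
    and min: "\<And>y z. y \<in> sdual C \<Longrightarrow> z \<in> sdual C \<Longrightarrow> m \<bullet> n \<le> y \<bullet> z"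
  shows "thickness C = arccos (- (m \<bullet> n))"
  unfolding thickness_def
proof (rule cInf_eq_minimum)
  have S: "m \<in> S2" "n \<in> S2" using m n sdual_S2 by blast+
  have min': "n \<bullet> m \<le> n \<bullet> z" if "z \<in> sdual C" for z
    using min[OF n that] by (simp add: inner_commute)
  have "swidth (hemi m) C = arccos (- (m \<bullet> n))" by (rule swidth_eq[OF C m n min[OF m]])
  moreover have "supports (hemi m) C" using minimizer_supports(3)[OF C n m min'] .
  ultimately show "arccos (- (m \<bullet> n)) \<in> (\<lambda>K. swidth K C) ` {K. supports K C}"
    by (metis (mono_tags, lifting) image_eqI mem_Collect_eq)
  fix x assume "x \<in> (\<lambda>K. swidth K C) ` {K. supports K C}"
  then obtain K where K: "supports K C" "x = swidth K C" by blast
  then obtain y where y: "y \<in> S2" "K = hemi y"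
    unfolding supports_def supports_at_def hemisphere_iff by blast
  have yd: "y \<in> sdual C" using supports_hemi[OF C y(1)] K y by simp
  obtain z where z: "z \<in> sdual C" "\<And>v. v \<in> sdual C \<Longrightarrow> y \<bullet> z \<le> y \<bullet> v"
    using sdual_minimizer_exists[OF C] by blast
  have "x = arccos (- (y \<bullet> z))" using swidth_eq[OF C yd z] K y by simp
  moreover have "arccos (- (m \<bullet> n)) \<le> arccos (- (y \<bullet> z))"
    using min[OF yd z(1)] S2_abs_inner[OF S] S2_abs_inner[OF y(1) sdual_S2[OF z(1)]]
    by (subst arccos_le_mono) auto
  ultimately show "arccos (- (m \<bullet> n)) \<le> x" by simp
qed

lemma thickness_attained:
  assumes C: "sconvex_body C"
  obtains m n where "m \<in> sdual C" "n \<in> sdual C" "\<forall>y\<in>sdual C. \<forall>z\<in>sdual C. m \<bullet> n \<le> y \<bullet> z"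
    "thickness C = arccos (- (m \<bullet> n))" "m \<noteq> n" "m \<noteq> - n"
proof -
  have "compact (sdual C \<times> sdual C)" by (intro compact_Times compact_sdual)
  moreover have "sdual C \<times> sdual C \<noteq> {}" using sdual_two_elements(1)[OF C] by auto
  moreover have "continuous_on (sdual C \<times> sdual C) (\<lambda>x. fst x \<bullet> snd x)"
    by (intro continuous_intros)
  ultimately have "\<exists>x\<in>sdual C \<times> sdual C. \<forall>y\<in>sdual C \<times> sdual C. fst x \<bullet> snd x \<le> fst y \<bullet> snd y"
    by (rule continuous_attains_inf)
  then obtain x where x: "x \<in> sdual C \<times> sdual C"
    "\<forall>y\<in>sdual C \<times> sdual C. fst x \<bullet> snd x \<le> fst y \<bullet> snd y" by (rule bexE)
  obtain m n where mn: "x = (m, n)" by (cases x)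
  have m: "m \<in> sdual C" "n \<in> sdual C" using x mn by auto
  have min: "\<And>y z. y \<in> sdual C \<Longrightarrow> z \<in> sdual C \<Longrightarrow> m \<bullet> n \<le> y \<bullet> z"
    using bspec[OF x(2), of "(y, z)" for y z] mn by simp
  have t: "thickness C = arccos (- (m \<bullet> n))" by (rule thickness_eq[OF C m]) (rule min)
  have n1: "m \<noteq> n" by (rule minimizer_supports(1)[OF C m min[OF m(1)]])
  have n2: "m \<noteq> - n" by (rule minimizer_supports(2)[OF C m min[OF m(1)]])
  show thesis by (rule that[OF m _ t n1 n2]) (intro ballI min)
qed

subsection \<open>Inequalities between inner products\<close>

lemma inner_convex_hull_ge:
  assumes "\<And>a. a \<in> A \<Longrightarrow> \<kappa> \<le> v \<bullet> a" "p \<in> convex hull A"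
  shows "\<kappa> \<le> v \<bullet> (p::real^3)"
proof -
  have "convex hull A \<subseteq> {p. v \<bullet> p \<ge> \<kappa>}"
    using assms(1) by (intro hull_minimal) (auto simp: convex_halfspace_ge)
  then show ?thesis using assms(2) by blast
qed

text \<open>The bound extends to the hull by linearity in each argument. Normalizing cannot lower a
  nonnegative product, since the hull lies in the unit ball; here \<open>0 \<le> \<kappa>\<close>
  enters.\<close>

lemma inner_sgn_hull_ge:
  fixes A :: "(real^3) set"
  assumes k: "0 \<le> \<kappa>" and A: "A \<subseteq> S2" "\<And>a b. a \<in> A \<Longrightarrow> b \<in> A \<Longrightarrow> \<kappa> \<le> a \<bullet> b"
    and p: "p \<in> convex hull A" "p \<noteq> 0" and q: "q \<in> convex hull A" "q \<noteq> 0"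
  shows "\<kappa> \<le> sgn p \<bullet> sgn q"
proof -
  have "\<kappa> \<le> a \<bullet> q" if "a \<in> A" for a
    using inner_convex_hull_ge[OF _ q(1)] A(2)[OF that] by blast
  then have pq: "\<kappa> \<le> p \<bullet> q"
    using inner_convex_hull_ge[OF _ p(1), of \<kappa> q] by (simp add: inner_commute)
  have "convex hull A \<subseteq> cball 0 1"
    using A(1) by (intro hull_minimal) (auto simp: convex_cball)
  then have n: "norm p \<le> 1" "norm q \<le> 1" using p q by auto
  then have "norm p * norm q \<le> 1" by (simp add: mult_le_one)
  moreover have "0 < norm p * norm q" using p q by simp
  ultimately have "p \<bullet> q \<le> (p \<bullet> q) / (norm p * norm q)"
    using pq k by (simp add: pos_le_divide_eq mult_left_le)
  also have "\<dots> = sgn p \<bullet> sgn q" by (simp add: sgn_div_norm divide_inverse)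
  finally show ?thesis using pq by simp
qed

text \<open>\<open>k, X, Y, M\<close> are the inner products of \<open>a\<close>, \<open>b\<close> and the normals \<open>m1\<close>, \<open>m2\<close> of two lunes;
  \<open>w * \<mu>1 * \<mu>2\<close> tells whether the normals lie on the same side of the great circle \<open>ab\<close>.\<close>

lemma pair_scalar_core:
  fixes c s k X Y M w \<mu>1 \<mu>2 :: real
  assumes cs: "0 < c" "0 < s" "c * c + s * s = 1" and k: "k \<le> c * c" and w: "w = 1 - k * k"
    and XY: "0 \<le> X" "X \<le> Y" "c * Y \<le> s * k"
    and g: "w * M + k * X * Y = w * \<mu>1 * \<mu>2" "w * (\<mu>1 * \<mu>1) = w - X * X" "w * (\<mu>2 * \<mu>2) = w - Y * Y"
    and q1: "0 \<le> c * X + s * M" and q2: "0 \<le> s * (c * k + s * X) - c * (c * Y + s * M)"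
  shows "k = c * c \<and> X = s * c \<and> Y = s * c \<and> M = s * s"
proof -
  have ss: "s * s = 1 - c * c" using cs(3) by simp
  have c1: "c < 1"
  proof (rule ccontr)
    assume "\<not> c < 1"
    then have "1 * 1 \<le> c * c" by (intro mult_mono) auto
    moreover have "0 < s * s" using cs by simp
    ultimately show False using cs(3) by simp
  qed
  have Y0: "0 \<le> Y" using XY by simp
  then have "0 \<le> s * k" using XY(3) cs(1) by (meson mult_nonneg_nonneg less_imp_le order_trans)
  then have k0: "0 \<le> k" using cs(2) by (simp add: zero_le_mult_iff)
  have "c * c < c * 1" using c1 cs(1) by (intro mult_strict_left_mono) auto
  then have kc: "k < c" using k by simp
  then have k1: "k < 1" using c1 by simp
  have kk: "k * k < c * c" using kc k0 by (simp add: mult_strict_mono')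
  have w_fact: "w = (1 - k) * (1 + k)" unfolding w by (simp add: algebra_simps)
  then have w0: "0 < w" using k1 k0 by simp
  \<comment> \<open>Since \<open>c * c * w - s * s * (k * k)\<close> equals
    \<open>c * c - k * k > 0\<close>, the bound on \<open>Y\<close> yields
    \<open>Y * Y < w\<close>.\<close>
  have "(c * Y) * (c * Y) \<le> (s * k) * (s * k)"
    using mult_mono'[OF XY(3) XY(3)] Y0 cs by simp
  then have YY: "c * c * (Y * Y) \<le> s * s * (k * k)" by (simp add: algebra_simps)
  have "c * c * w - s * s * (k * k) = c * c - k * k" unfolding w ss by (simp add: algebra_simps)
  then have "c * c * (Y * Y) < c * c * w" using YY kk by simp
  then have wY: "Y * Y < w" using cs by simp
  \<comment> \<open>The square of \<open>P\<close> is known from \<open>g\<close>, and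
    \<open>X \<le> Y\<close> makes \<open>w - Y * Y\<close> a lower bound for its absolute value;
    only the sign of \<open>P\<close> is open.\<close>
  define P where "P = w * \<mu>1 * \<mu>2"
  have PP: "P\<^sup>2 = (w - X * X) * (w - Y * Y)"
    unfolding P_def g(2,3)[symmetric] by (simp add: power2_eq_square algebra_simps)
  have "X * X \<le> Y * Y" using XY by (intro mult_mono) auto
  then have "(w - Y * Y) * (w - Y * Y) \<le> (w - X * X) * (w - Y * Y)"
    using wY by (intro mult_right_mono) auto
  then have "(w - Y * Y)\<^sup>2 \<le> P\<^sup>2" using PP by (simp add: power2_eq_square)
  then have absP: "w - Y * Y \<le> \<bar>P\<bar>"
    using wY by (metis abs_le_square_iff abs_of_pos diff_gt_0_iff_gt)
  have wM: "w * M = P - k * X * Y" using g(1) by (simp add: P_def)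
  \<comment> \<open>Normals on opposite sides would make \<open>M\<close> so small that
    \<open>q1\<close> fails: the resulting bound grows with \<open>X\<close>, so \<open>X\<close>
    may be replaced by \<open>Y\<close>, which leads to \<open>w \<le> Y * Y\<close>.\<close>
  have Ppos: "0 \<le> P"
  proof (rule ccontr)
    assume "\<not> 0 \<le> P"
    then have 1: "w * M \<le> - (w - Y * Y) - k * X * Y" using absP wM by simp
    have "0 \<le> w * (c * X + s * M)" using w0 q1 by simp
    also have "\<dots> = w * c * X + s * (w * M)" by (simp add: algebra_simps)
    also have "\<dots> \<le> w * c * X + s * (- (w - Y * Y) - k * X * Y)"
      using 1 cs by simp
    finally have 2: "s * w \<le> X * (w * c - s * k * Y) + s * (Y * Y)" by (simp add: algebra_simps)
    have "c * (w * c - s * k * Y) = c * c * w - s * k * (c * Y)" by (simp add: algebra_simps)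
    moreover have "s * k * (c * Y) \<le> s * k * (s * k)"
      using XY(3) \<open>0 \<le> s * k\<close> by (rule mult_left_mono)
    ultimately have "0 \<le> c * (w * c - s * k * Y)"
      using \<open>c * c * w - s * s * (k * k) = c * c - k * k\<close> kk by (simp add: algebra_simps)
    then have "0 \<le> w * c - s * k * Y" using cs by (simp add: zero_le_mult_iff)
    then have "X * (w * c - s * k * Y) \<le> Y * (w * c - s * k * Y)"
      using XY by (intro mult_right_mono) auto
    then have "s * w \<le> w * (c * Y) + s * (1 - k) * (Y * Y)" using 2 by (simp add: algebra_simps)
    also have "\<dots> \<le> w * (s * k) + s * (1 - k) * (Y * Y)" using XY(3) w0 by simp
    finally have "(s * (1 - k)) * w \<le> (s * (1 - k)) * (Y * Y)" by (simp add: algebra_simps)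
    moreover have "0 < s * (1 - k)" using cs k1 by simp
    ultimately show False using wY by (simp add: mult_le_cancel_left)
  qed
  then have 1: "w - Y * Y - k * X * Y \<le> w * M" using absP wM by simp
  \<comment> \<open>Inserting the lower bound for \<open>M\<close> into \<open>q2\<close> gives an
    inequality that factors. In \<open>main\<close> the left side is nonnegative, which forces
    \<open>c * (1 - k) \<le> s * Y\<close>.\<close>
  have "0 \<le> w * (s * (c * k + s * X) - c * (c * Y + s * M))" using w0 q2 by simp
  also have "\<dots> = w * (s * c * k + s * s * X - c * c * Y) - c * s * (w * M)"
    by (simp add: algebra_simps)
  also have "\<dots> \<le> w * (s * c * k + s * s * X - c * c * Y) - c * s * (w - Y * Y - k * X * Y)"
    using 1 cs by simp
  also have "\<dots> = (1 + k) * (c * Y + s * (1 - k)) * (s * Y - c * (1 - k))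
      - (Y - X) * (w * (s * s) + c * s * k * Y)"
    unfolding w_fact by (simp add: algebra_simps)
  finally have main: "(Y - X) * (w * (s * s) + c * s * k * Y)
      \<le> (1 + k) * (c * Y + s * (1 - k)) * (s * Y - c * (1 - k))" by simp
  have pos: "0 < w * (s * s) + c * s * k * Y" using w0 cs k0 Y0 by (simp add: add_pos_nonneg)
  have pos2: "0 < (1 + k) * (c * Y + s * (1 - k))"
    using k0 k1 cs Y0 by (intro mult_pos_pos) (auto simp: add_nonneg_pos)
  have "0 \<le> (Y - X) * (w * (s * s) + c * s * k * Y)" using XY pos by simp
  then have "0 \<le> (1 + k) * (c * Y + s * (1 - k)) * (s * Y - c * (1 - k))" using main by simp
  then have low: "c * (1 - k) \<le> s * Y" using pos2 by (simp add: zero_le_mult_iff)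
  \<comment> \<open>Combined with \<open>c * Y \<le> s * k\<close> this gives
    \<open>c * c * (1 - k) \<le> s * s * k\<close>, that is \<open>c * c \<le> k\<close>; so
    \<open>k = c * c\<close>, and the other values follow.\<close>
  have "c * (c * (1 - k)) \<le> c * (s * Y)" using low cs by simp
  also have "\<dots> = s * (c * Y)" by simp
  also have "\<dots> \<le> s * (s * k)" using XY(3) cs by simp
  also have "\<dots> = (1 - c * c) * k" using ss by (metis mult.assoc)
  finally have "c * c \<le> k" by (simp add: algebra_simps)
  then have kcc: "k = c * c" using k by simp
  then have u: "1 - k = s * s" using ss by simp
  have "s * (s * c) \<le> s * Y" using low u by (simp add: algebra_simps)
  then have "s * c \<le> Y" using cs by simp
  moreover have "c * Y \<le> c * (s * c)" using XY(3) kcc by (simp add: algebra_simps)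
  then have "Y \<le> s * c" using cs by simp
  ultimately have Y: "Y = s * c" by simp
  have "s * Y - c * (1 - k) = 0" unfolding Y u by simp
  then have "(Y - X) * (w * (s * s) + c * s * k * Y) \<le> 0" using main by simp
  then have X: "X = s * c" using pos XY Y by (simp add: mult_le_0_iff)
  have "P\<^sup>2 = (w - Y * Y)\<^sup>2" using PP X Y by (simp add: power2_eq_square)
  then have "P = w - Y * Y" using Ppos wY by (simp add: power2_eq_iff)
  then have "w * M = w - (1 + k) * (Y * Y)" using wM X Y by (simp add: algebra_simps)
  also have "\<dots> = (1 + k) * ((s * s) * (1 - c * c))" unfolding w_fact u Y by (simp add: algebra_simps)
  also have "\<dots> = w * (s * s)" unfolding w_fact u ss[symmetric] by simp
  finally have "M = s * s" using w0 by simp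
  then show ?thesis using kcc X Y by simp
qed

text \<open>Coordinates in the frame \<open>a\<close>, \<open>u\<close>, \<open>v\<close>, where
  \<open>u\<close> is the normalized part of \<open>b\<close> orthogonal to \<open>a\<close> and
  \<open>v\<close> is normal to the great circle through \<open>a\<close> and \<open>b\<close>. The
  numbers \<open>\<mu>1\<close>, \<open>\<mu>2\<close> are the coordinates of the normals along
  \<open>v\<close>; the identities are \<open>m1 \<bullet> m2\<close>,
  \<open>m1 \<bullet> m1\<close> and \<open>m2 \<bullet> m2\<close> multiplied by
  \<open>w\<close>.\<close>

lemma gram_frame:
  fixes a b m1 m2 :: "real^3"
  assumes S: "a \<in> S2" "b \<in> S2" "m1 \<in> S2" "m2 \<in> S2" and o: "m1 \<bullet> a = 0" "m2 \<bullet> b = 0"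
    and k: "(a \<bullet> b) * (a \<bullet> b) < 1" and w: "w = 1 - (a \<bullet> b) * (a \<bullet> b)"
  obtains \<mu>1 \<mu>2 where
    "w * (m1 \<bullet> m2) + (a \<bullet> b) * (b \<bullet> m1) * (a \<bullet> m2) = w * \<mu>1 * \<mu>2"
    "w * (\<mu>1 * \<mu>1) = w - (b \<bullet> m1) * (b \<bullet> m1)" "w * (\<mu>2 * \<mu>2) = w - (a \<bullet> m2) * (a \<bullet> m2)"
proof -
  note sq = S[THEN S2_inner_self]
  have w0: "0 < w" using k w by simp
  define t where "t = sqrt w"
  have t: "0 < t" "t * t = w" using w0 by (auto simp: t_def)
  define u where "u = (1 / t) *\<^sub>R (b - (a \<bullet> b) *\<^sub>R a)"
  have "u \<bullet> u = 1"
    using sq t w by (simp add: u_def inner_diff_left inner_diff_right inner_commute field_simps)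
  then have uS: "u \<in> S2" by (rule S2_I)
  have au: "a \<bullet> u = 0" using sq by (simp add: u_def inner_diff_right)
  define v where "v = cross3 a u"
  have v: "v \<in> S2" "a \<bullet> v = 0" "u \<bullet> v = 0" using cross3_frame[OF S(1) uS au] by (auto simp: v_def)
  note ex = orthonormal_expand(2)[OF S(1) uS v(1) au v(2,3)]
  have m1: "m1 \<bullet> u = (b \<bullet> m1) / t" using o by (simp add: u_def inner_diff_right inner_commute)
  have m2: "m2 \<bullet> u = - (a \<bullet> b) * (a \<bullet> m2) / t"
    using o by (simp add: u_def inner_diff_right inner_commute)
  have t2: "x / t * (y / t) = x * y / w" for x y using t by (simp add: field_simps)
  have e1: "m1 \<bullet> m2 = - ((a \<bullet> b) * (b \<bullet> m1) * (a \<bullet> m2)) / w + (m1 \<bullet> v) * (m2 \<bullet> v)"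
    unfolding ex[of m1 m2] o m1 m2 t2 by (simp add: mult.commute mult.left_commute)
  have e2: "1 = (b \<bullet> m1) * (b \<bullet> m1) / w + (m1 \<bullet> v) * (m1 \<bullet> v)"
    using ex[of m1 m1] unfolding o m1 t2 sq by simp
  have e3: "1 = (a \<bullet> m2) * (a \<bullet> m2) + (a \<bullet> b) * (a \<bullet> b) * ((a \<bullet> m2) * (a \<bullet> m2)) / w + (m2 \<bullet> v) * (m2 \<bullet> v)"
    using ex[of m2 m2] unfolding m2 t2 sq by (simp add: inner_commute mult.commute mult.left_commute)
  show thesis
  proof (rule that[of "m1 \<bullet> v" "m2 \<bullet> v"])
    show "w * (m1 \<bullet> m2) + (a \<bullet> b) * (b \<bullet> m1) * (a \<bullet> m2) = w * (m1 \<bullet> v) * (m2 \<bullet> v)"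
      unfolding e1 using w0 by (simp add: right_diff_distrib)
    show "w * ((m1 \<bullet> v) * (m1 \<bullet> v)) = w - (b \<bullet> m1) * (b \<bullet> m1)"
      using e2 w0 by (simp add: field_simps)
    have "w = w * 1" by simp
    also have "\<dots> = (w + (a \<bullet> b) * (a \<bullet> b)) * ((a \<bullet> m2) * (a \<bullet> m2)) + w * ((m2 \<bullet> v) * (m2 \<bullet> v))"
      by (subst e3) (use w0 in \<open>simp add: distrib_left distrib_right\<close>)
    finally show "w * ((m2 \<bullet> v) * (m2 \<bullet> v)) = w - (a \<bullet> m2) * (a \<bullet> m2)" using w by simp
  qed
qed

text \<open>Expanding \<open>s * s\<close> as \<open>s\<close> times the product of \<open>e\<close>
  and \<open>n\<close> and inserting both bounds on \<open>n\<close> leaves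
  \<open>0 \<le> e1 * (s * n1 - s * s * e1)\<close>. As \<open>n1 < 0\<close>, this forces
  \<open>e1 = 0\<close>, and \<open>c * e2 \<le> s * e3\<close> with unit length gives the
  claim.\<close>

lemma quarter_scalar_core_neg:
  fixes c s e1 e2 e3 n1 n2 n3 :: real
  assumes cs: "0 < c" "0 < s" "c * c + s * s = 1"
    and e: "0 \<le> e1" "0 \<le> e2" "c * e2 \<le> s * e3" "0 \<le> e3"
    and ee: "e1 * e1 + e2 * e2 + e3 * e3 = 1"
    and ne: "e1 * n1 + e2 * n2 + e3 * n3 = s"
    and n: "n3 \<le> s * e3" "s * n2 + c * n3 \<le> s * (s * e2 + c * e3)" and neg: "n1 < 0"
  shows "c \<le> e3"
proof -
  have "s * s = e1 * (s * n1) + e2 * (s * n2) + s * e3 * n3"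
    unfolding ne[symmetric] by (simp add: algebra_simps)
  also have "\<dots> \<le> e1 * (s * n1) + e2 * (s * (s * e2 + c * e3) - c * n3) + s * e3 * n3"
    using n(2) e by (simp add: mult_left_mono)
  also have "\<dots> = e1 * (s * n1) + s * s * (e2 * e2) + c * s * e2 * e3 + (s * e3 - c * e2) * n3"
    by (simp add: algebra_simps)
  also have "\<dots> \<le> e1 * (s * n1) + s * s * (e2 * e2) + c * s * e2 * e3 + (s * e3 - c * e2) * (s * e3)"
    using n(1) e by (simp add: mult_left_mono)
  also have "\<dots> = e1 * (s * n1) + s * s * (1 - e1 * e1)"
    unfolding ee[symmetric] by (simp add: algebra_simps)
  finally have "0 \<le> e1 * (s * n1 - s * s * e1)" by (simp add: algebra_simps)
  moreover have "s * n1 - s * s * e1 < 0"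
    using neg cs e by (simp add: mult_pos_neg less_le_trans)
  ultimately have "e1 = 0" using e by (simp add: zero_le_mult_iff)
  then have "e2 * e2 = 1 - e3 * e3" using ee by simp
  moreover have "(c * e2) * (c * e2) \<le> (s * e3) * (s * e3)"
    using mult_mono'[OF e(3) e(3)] e cs by simp
  then have "c * c * (e2 * e2) \<le> s * s * (e3 * e3)" by (simp add: algebra_simps)
  ultimately have "c * c * (1 - e3 * e3) \<le> s * s * (e3 * e3)" by simp
  then have "c * c \<le> (c * c + s * s) * (e3 * e3)" by (simp add: algebra_simps)
  then have "c\<^sup>2 \<le> e3\<^sup>2" using cs by (simp add: power2_eq_square)
  then show ?thesis using e(4) by (rule power2_le_imp_le)
qed

text \<open>The numbers are the coordinates, in the frame \<open>u\<close>, \<open>v\<close>,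
  \<open>p\<close> of \<open>quarter\<close>, of a point \<open>e\<close> of \<open>E\<close> and of
  the center \<open>n\<close> of the second hemisphere of its lune. The claim is that
  \<open>e\<close> is within the thickness of \<open>p\<close>.\<close>

lemma quarter_scalar_core:
  fixes c s e1 e2 e3 n1 n2 n3 :: real
  assumes cs: "0 < c" "0 < s" "c * c + s * s = 1"
    and e: "0 \<le> e1" "0 \<le> e2" "c * e1 \<le> s * e3" "c * e2 \<le> s * e3"
    and ee: "e1 * e1 + e2 * e2 + e3 * e3 = 1" and nn: "n1 * n1 + n2 * n2 + n3 * n3 = 1"
    and ne: "e1 * n1 + e2 * n2 + e3 * n3 = s"
    and n: "0 \<le> n3" "n3 \<le> s * e3" "s * n1 \<le> e1" "s * n2 \<le> e2"
      "s * n1 + c * n3 \<le> s * (s * e1 + c * e3)" "s * n2 + c * n3 \<le> s * (s * e2 + c * e3)"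
  shows "c \<le> e3"
proof -
  have "0 \<le> c * e1" using e cs by simp
  then have "0 \<le> s * e3" using e by linarith
  then have e3: "0 \<le> e3" using cs by (simp add: zero_le_mult_iff)
  consider "n1 < 0" | "n2 < 0" | "0 \<le> n1" "0 \<le> n2" by linarith
  then show ?thesis
  proof cases
    case 1
    then show ?thesis using quarter_scalar_core_neg[OF cs e(1,2,4) e3 ee ne n(2,6)] by simp
  next
    case 2
    then show ?thesis
      using quarter_scalar_core_neg[OF cs e(2,1,3) e3 _ _ n(2,5), of n2] ee ne by (simp add: algebra_simps)
  next
    case 3
    have i1: "0 \<le> n1 * (e1 - s * n1)" and i2: "0 \<le> n2 * (e2 - s * n2)" using 3 n by simp_all
    \<comment> \<open>The sum is the product of \<open>e\<close> and \<open>n\<close> minus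
      \<open>s\<close> times the square of \<open>n\<close>. The first two terms are nonnegative,
      and a positive \<open>n3\<close> would give \<open>e3 \<le> s * s * e3\<close>; so every term
      vanishes.\<close>
    have sum: "n1 * (e1 - s * n1) + n2 * (e2 - s * n2) + n3 * (e3 - s * n3) = 0"
    proof -
      have "n1 * (e1 - s * n1) + n2 * (e2 - s * n2) + n3 * (e3 - s * n3)
          = (e1 * n1 + e2 * n2 + e3 * n3) - s * (n1 * n1 + n2 * n2 + n3 * n3)"
        by (simp add: algebra_simps)
      then show ?thesis using nn ne by simp
    qed
    have n3: "n3 = 0"
    proof (rule ccontr)
      assume "n3 \<noteq> 0"
      then have "0 < n3" using n by simp
      moreover have "n3 * (e3 - s * n3) \<le> 0" using i1 i2 sum by linarith
      ultimately have "e3 \<le> s * n3" by (simp add: mult_le_0_iff)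
      also have "\<dots> \<le> s * (s * e3)" using n cs by simp
      finally have "e3 \<le> s * s * e3" by simp
      then have "c * c * e3 \<le> 0" using cs(3) by (metis add_diff_cancel_right' diff_le_0_iff_le left_diff_distrib mult_1)
      then have "e3 \<le> 0" using cs by (simp add: mult_le_0_iff)
      then show False using n \<open>0 < n3\<close> e3 by simp
    qed
    then have "n1 * (e1 - s * n1) + n2 * (e2 - s * n2) = 0" using sum by simp
    then have z: "n1 * (e1 - s * n1) = 0 \<and> n2 * (e2 - s * n2) = 0"
      using add_nonneg_eq_0_iff[OF i1 i2] by blast
    have n12: "n1 * n1 + n2 * n2 = 1" using nn n3 by simp
    consider "n1 = 0" | "n2 = 0" | "e1 = s * n1" "e2 = s * n2" using z by auto
    then show ?thesis
    proof cases
      case 1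
      then have "n2 = 1" using n12 3 by (simp add: square_eq_1_iff)
      then have "c * s \<le> s * e3" using z e(4) by simp
      then show ?thesis using cs by (simp add: mult.commute)
    next
      case 2
      then have "n1 = 1" using n12 3 by (simp add: square_eq_1_iff)
      then have "c * s \<le> s * e3" using z e(3) by simp
      then show ?thesis using cs by (simp add: mult.commute)
    next
      case 3
      have "e1 * e1 + e2 * e2 = s * s * (n1 * n1 + n2 * n2)"
        unfolding 3 by (simp add: algebra_simps)
      then have "e3\<^sup>2 = c\<^sup>2" using ee cs(3) n12 by (simp add: power2_eq_square)
      then show ?thesis using e3 cs by (simp add: power2_eq_iff)
    qed
  qed
qed

subsection \<open>Reduced bodies and their lune centers\<close>

locale reduced =
  fixes R :: "(real^3) set" and c s :: real
  assumes red: "reduced_body R"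
    and c: "c = cos (thickness R)" and s: "s = sin (thickness R)"
begin

lemma body: "sconvex_body R"
  using red by (simp add: reduced_body_def)

lemma R_S2: "x \<in> R \<Longrightarrow> x \<in> S2"
  using sconvex_body_S2[OF body] .

lemma sdual_inner_ge: "y \<in> sdual R \<Longrightarrow> z \<in> sdual R \<Longrightarrow> - c \<le> y \<bullet> z"
  and thickness_bounds: "0 < thickness R" "thickness R < pi"
proof -
  obtain m n where m: "m \<in> sdual R" and n: "n \<in> sdual R"
    and min: "\<forall>y\<in>sdual R. \<forall>z\<in>sdual R. m \<bullet> n \<le> y \<bullet> z"
    and t: "thickness R = arccos (- (m \<bullet> n))" and ne: "m \<noteq> n" "m \<noteq> - n"
    by (rule thickness_attained[OF body])
  have S: "m \<in> S2" "n \<in> S2" using m n sdual_S2 by blast+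
  have "\<bar>m \<bullet> n\<bar> \<le> 1" using S2_abs_inner[OF S] .
  then have k: "c = - (m \<bullet> n)" unfolding c t by (intro cos_arccos) auto
  show "- c \<le> y \<bullet> z" if "y \<in> sdual R" "z \<in> sdual R" using min that k by simp
  have "m \<bullet> n < 1" "-1 < m \<bullet> n"
    using S2_inner_le_1[OF S] S2_inner_eq_1[OF S] S2_inner_eq_minus_1[OF S] ne
    by (auto simp: less_le)
  then show "0 < thickness R" "thickness R < pi"
    unfolding t using arccos_lt_bounded[of "- (m \<bullet> n)"] by auto
qed

lemma s_pos: "0 < s"
  using thickness_bounds by (simp add: s sin_gt_zero)

lemma c2_s2: "c * c + s * s = 1"
  using sin_cos_squared_add3[of "thickness R"] by (simp add: c s)

lemma c_bounds: "-1 < c" "c < 1"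
  using c2_s2 s_pos
  by (smt (verit) mult_pos_pos mult_le_one mult_minus_left mult_minus_right mult_less_cancel_left1)+

lemma thickness_arccos: "thickness R = arccos c"
  using thickness_bounds by (simp add: c arccos_cos)

lemma norm_center:
  assumes "m \<in> S2" "n \<in> S2" "m \<bullet> n = - c"
  shows "norm (m + c *\<^sub>R n) = s"
proof -
  have "(m + c *\<^sub>R n) \<bullet> (m + c *\<^sub>R n) = 1 - c * c"
    using S2_inner_self[OF assms(1)] S2_inner_self[OF assms(2)] assms(3)
    by (simp add: inner_add_left inner_add_right inner_commute)
  also have "\<dots> = s\<^sup>2" using c2_s2 by (simp add: power2_eq_square)
  finally show ?thesis using s_pos by (simp add: norm_eq_sqrt_inner)
qed

text \<open>A pair with product \<open>- c\<close> is extremal, so the minimizer lemma applies; the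
  projection is \<open>m + c *\<^sub>R n\<close>, of norm \<open>s\<close>.\<close>

lemma center_mem:
  assumes "m \<in> sdual R" "n \<in> sdual R" "m \<bullet> n = - c"
  shows "(1 / s) *\<^sub>R (m + c *\<^sub>R n) \<in> R"
proof -
  have S: "m \<in> S2" "n \<in> S2" using assms sdual_S2 by blast+
  have min: "m \<bullet> n \<le> m \<bullet> z" if "z \<in> sdual R" for z
    using sdual_inner_ge[OF assms(1) that] assms(3) by simp
  have "m \<bullet> n \<noteq> 1" "m \<bullet> n \<noteq> -1" using c_bounds assms(3) by auto
  then have "m \<noteq> n" "m \<noteq> - n"
    using S2_inner_eq_1[OF S] S2_inner_eq_minus_1[OF S] by auto
  then have "sgn (m - (m \<bullet> n) *\<^sub>R n) \<in> R"
    using minimizer_center_mem[OF body assms(2) S(1)] min by blast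
  then show ?thesis using norm_center[OF S assms(3)] assms(3) by (simp add: sgn_div_norm divide_inverse)
qed

text \<open>Cutting the reduced body \<open>R\<close> makes it thinner, so the dual of the cut body
  has a pair with product below \<open>- c\<close>. One of the two points is new, and the center of
  the side on its circle lies on the cut, since otherwise that point would already be in
  \<open>sdual R\<close>.\<close>

lemma cut_pair:
  assumes x0: "x0 \<in> R" "0 < z \<bullet> x0" and x1: "x1 \<in> R" "z \<bullet> x1 < 0"
  obtains m n where "m \<in> sdual {x\<in>R. 0 \<le> z \<bullet> x}" "n \<in> sdual {x\<in>R. 0 \<le> z \<bullet> x}"
    "m \<bullet> n < - c" "sgn (m - (m \<bullet> n) *\<^sub>R n) \<in> R" "z \<bullet> sgn (m - (m \<bullet> n) *\<^sub>R n) = 0"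
proof -
  let ?Z = "{x\<in>R. 0 \<le> z \<bullet> x}"
  have Z: "sconvex_body ?Z" by (rule sconvex_body_cut[OF body x0])
  have "?Z \<noteq> R" using x1 by force
  then have less: "thickness ?Z < thickness R"
    using red Z unfolding reduced_body_def by blast
  obtain m n where m: "m \<in> sdual ?Z" and n: "n \<in> sdual ?Z"
    and min0: "\<forall>y\<in>sdual ?Z. \<forall>z'\<in>sdual ?Z. m \<bullet> n \<le> y \<bullet> z'"
    and t: "thickness ?Z = arccos (- (m \<bullet> n))" and ne: "m \<noteq> n" "m \<noteq> - n"
    by (rule thickness_attained[OF Z])
  have min: "m \<bullet> n \<le> y \<bullet> z'" if "y \<in> sdual ?Z" "z' \<in> sdual ?Z" for y z'
    using min0 that by blast
  have S: "m \<in> S2" "n \<in> S2" using m n sdual_S2 by blast+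
  have "arccos (- (m \<bullet> n)) < arccos c" using less t thickness_arccos by simp
  then have mn: "m \<bullet> n < - c"
    using arccos_less_mono[of "- (m \<bullet> n)" c] S2_abs_inner[OF S] c_bounds by (simp add: abs_le_iff)
  have main: "sgn (m - (m \<bullet> n) *\<^sub>R n) \<in> R \<and> z \<bullet> sgn (m - (m \<bullet> n) *\<^sub>R n) = 0"
    if m: "m \<in> sdual ?Z" and n: "n \<in> sdual ?Z" and ne: "m \<noteq> n" "m \<noteq> - n" and nR: "n \<notin> sdual R"
      and min: "\<And>z'. z' \<in> sdual ?Z \<Longrightarrow> m \<bullet> n \<le> m \<bullet> z'" for m n
  proof -
    let ?x = "sgn (m - (m \<bullet> n) *\<^sub>R n)"
    have S: "m \<in> S2" "n \<in> S2" using m n sdual_S2 by blast+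
    have "?x \<in> ?Z" by (rule minimizer_center_mem[OF Z n S(1) min ne])
    then have xR: "?x \<in> R" "0 \<le> z \<bullet> ?x" by auto
    have nx: "n \<bullet> ?x = 0"
      using S2_inner_self[OF S(2)] by (simp add: inner_sgn_right inner_diff_right inner_commute)
    have "\<not> 0 < z \<bullet> ?x"
    proof
      assume pos: "0 < z \<bullet> ?x"
      have "0 \<le> n \<bullet> y" if y: "y \<in> R" for y
      proof (cases "0 \<le> z \<bullet> y")
        case True
        then show ?thesis using n y sdualD by blast
      next
        case False
        \<comment> \<open>With this \<open>t\<close> the combination of \<open>?x\<close> and
          \<open>y\<close> lies on the cut, where \<open>n\<close> is nonnegative; as
          \<open>n\<close> vanishes at \<open>?x\<close>, it is nonnegative at
          \<open>y\<close>.\<close>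
        define t where "t = (z \<bullet> ?x) / (- (z \<bullet> y))"
        have t: "0 < t" using pos False by (simp add: t_def divide_pos_neg)
        have "sgn (1 *\<^sub>R ?x + t *\<^sub>R y) \<in> R"
          using sconvex_comb[OF _ xR(1) y, of 1 t] t body by (simp add: sconvex_body_def)
        moreover have "z \<bullet> (1 *\<^sub>R ?x + t *\<^sub>R y) = 0"
          using False by (simp add: inner_add_right inner_diff_right t_def)
        ultimately have "sgn (1 *\<^sub>R ?x + t *\<^sub>R y) \<in> ?Z" by (simp add: inner_sgn_right)
        then have "0 \<le> n \<bullet> sgn (1 *\<^sub>R ?x + t *\<^sub>R y)" using n sdualD by blast
        then have "0 \<le> t * (n \<bullet> y)" using nx by (simp add: inner_sgn_nonneg inner_add_right)
        then show ?thesis using t by (simp add: zero_le_mult_iff)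
      qed
      then show False using nR S by (auto simp: sdual_def)
    qed
    then show ?thesis using xR by simp
  qed
  consider "n \<notin> sdual R" | "m \<notin> sdual R" using sdual_inner_ge[of m n] mn by fastforce
  then show thesis
  proof cases
    case 1
    then show ?thesis using main[OF m n ne 1 min[OF m]] that[OF m n mn] by blast
  next
    case 2
    have "n \<noteq> m" "n \<noteq> - m" using ne by auto
    moreover have "n \<bullet> m \<le> n \<bullet> z'" if "z' \<in> sdual ?Z" for z'
      using min[OF n that] by (simp add: inner_commute)
    ultimately show ?thesis
      using main[OF n m _ _ 2] that[OF n m] mn by (simp add: inner_commute)
  qed
qed

section \<open>Side centers of thinnest lunes generate \<open>R\<close>\<close>

definition E :: "(real^3) set" where
  "E = {e \<in> R. \<exists>m\<in>sdual R. m \<bullet> e = 0 \<and> s *\<^sub>R e - c *\<^sub>R m \<in> sdual R}"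

lemma E_subset: "E \<subseteq> R"
  by (auto simp: E_def)

text \<open>As the second hemisphere center is written in terms of \<open>e\<close> and
  \<open>m\<close>, the defining condition is closed, and \<open>E\<close> is a projection of a
  compact set of pairs.\<close>

lemma compact_E: "compact E"
proof -
  let ?W = "(R \<times> sdual R) \<inter> ({p. snd p \<bullet> fst p = 0} \<inter>
    ((\<lambda>p. s *\<^sub>R fst p - c *\<^sub>R snd p) -` sdual R))"
  have "compact (R \<times> sdual R)" using sconvex_body_compact[OF body] compact_sdual by (rule compact_Times)
  moreover have "closed ({p :: (real^3) \<times> (real^3). snd p \<bullet> fst p = 0} \<inter>
    ((\<lambda>p. s *\<^sub>R fst p - c *\<^sub>R snd p) -` sdual R))"
    by (intro closed_Int closed_Collect_eq closed_vimage closed_sdual continuous_intros)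
  ultimately have "compact ?W" by (rule compact_Int_closed)
  then have "compact (fst ` ?W)" by (intro compact_continuous_image continuous_intros)
  moreover have "E = fst ` ?W" unfolding E_def by force
  ultimately show ?thesis by simp
qed

lemma E_I:
  assumes "m \<in> sdual R" "n \<in> sdual R" "m \<bullet> n = - c"
  shows "(1 / s) *\<^sub>R (m + c *\<^sub>R n) \<in> E"
proof -
  have "n \<bullet> (m + c *\<^sub>R n) = 0"
    using S2_inner_self[OF sdual_S2[OF assms(2)]] assms(3)
    by (simp add: inner_add_right inner_commute)
  then show ?thesis using center_mem[OF assms] assms s_pos by (auto simp: E_def intro!: bexI[of _ n])
qed

text \<open>Central projection onto the plane \<open>d \<bullet> x = 1\<close> will turn
  \<open>R\<close> into a compact convex set, to which the Krein-Milman theorem applies.\<close>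

lemma positive_functional: obtains d where "\<And>x. x \<in> R \<Longrightarrow> 0 < d \<bullet> x"
proof -
  have "closed (convex hull R)" "0 \<notin> convex hull R"
    using compact_imp_closed[OF compact_convex_hull[OF sconvex_body_compact[OF body]]]
      sconvex_hull_nonzero[OF body] by auto
  then obtain a b where "a \<bullet> 0 < b" "\<forall>x\<in>convex hull R. b < a \<bullet> x"
    using separating_hyperplane_closed_point[OF convex_convex_hull] by blast
  then have "0 < a \<bullet> x" if "x \<in> R" for x using hull_inc[OF that, of convex] by fastforce
  then show thesis by (rule that)
qed

lemma R_not_singleton: "\<exists>x\<in>R. x \<noteq> y"
proof (rule ccontr)
  assume "\<not> ?thesis"
  then have sub: "R \<subseteq> {y}" by blast
  obtain w :: "real^3" where w: "w \<noteq> 0" "orthogonal y w"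
    using orthogonal_to_vector_exists[of y] by auto
  have "sgn w \<in> sdual R" "- sgn w \<in> sdual R"
    using sub sgn_S2[OF w(1)] w
    by (auto simp: sdual_def orthogonal_def inner_commute inner_sgn_right)
  then show False using sdual_not_antipodal[OF body, of "- sgn w" "sgn w"] by simp
qed

text \<open>Cutting off a small cap around \<open>e\<close> leaves a body of smaller thickness; the center of the
  side of its thinnest lune that was not already supporting lies on the cut, hence near \<open>e\<close>.\<close>

lemma cap_pair:
  fixes d :: "real^3"
  defines "g \<equiv> \<lambda>x. (1 / (d \<bullet> x)) *\<^sub>R x"
  assumes d: "\<And>x. x \<in> R \<Longrightarrow> 0 < d \<bullet> x"
    and e: "e extreme_point_of (g ` R)" and cvx: "convex (g ` R)" and cpt: "compact (g ` R)"
    and y0: "y0 \<in> R" "r \<le> dist (g y0) e" and r: "0 < r"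
  obtains m n where "m \<in> S2" "n \<in> S2" "m \<bullet> n < - c" "sgn (m - (m \<bullet> n) *\<^sub>R n) \<in> R"
    "dist (g (sgn (m - (m \<bullet> n) *\<^sub>R n))) e < r"
    "\<forall>y\<in>R. r \<le> dist (g y) e \<longrightarrow> 0 \<le> m \<bullet> y \<and> 0 \<le> n \<bullet> y"
proof -
  let ?P = "g ` R" and ?H = "convex hull (g ` R - ball e r)"
  have dg: "d \<bullet> g x = 1" if "x \<in> R" for x using d[OF that] by (simp add: g_def)
  have "compact (?P - ball e r)" using cpt by (simp add: compact_diff)
  then have "closed ?H" by (simp add: compact_convex_hull compact_imp_closed)
  moreover have "e \<notin> ?H"
  proof -
    \<comment> \<open>Removing an extreme point leaves a convex set, so the hull of the part outside
      the ball misses \<open>e\<close>.\<close>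
    have "convex (?P - {e})" using e extreme_point_of_stillconvex[OF cvx] by blast
    moreover have "?P - ball e r \<subseteq> ?P - {e}" using r by auto
    ultimately have "?H \<subseteq> ?P - {e}" by (rule hull_minimal[rotated])
    then show ?thesis by blast
  qed
  ultimately obtain a b where ab: "a \<bullet> e < b" "\<forall>y\<in>?H. b < a \<bullet> y"
    using separating_hyperplane_closed_point[OF convex_convex_hull] by blast
  \<comment> \<open>On the plane where \<open>d\<close> has value 1, the linear functional
    \<open>z\<close> is the affine function \<open>a \<bullet> y - b\<close>: negative at
    \<open>e\<close>, positive outside the cap.\<close>
  define z where "z = a - b *\<^sub>R d"
  have zg: "z \<bullet> x = (d \<bullet> x) * (a \<bullet> g x - b)" if "x \<in> R" for x
    using d[OF that] by (simp add: z_def g_def inner_diff_left right_diff_distrib)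
  have far: "0 < z \<bullet> x" if "x \<in> R" "r \<le> dist (g x) e" for x
  proof -
    have "g x \<in> ?P - ball e r" using that by (simp add: dist_commute)
    then have "b < a \<bullet> g x" using ab(2) hull_inc by metis
    then show ?thesis using zg[OF that(1)] d[OF that(1)] by simp
  qed
  obtain x1 where x1: "x1 \<in> R" "e = g x1" using e unfolding extreme_point_of_def by blast
  have "z \<bullet> x1 < 0" using zg[OF x1(1)] d[OF x1(1)] ab(1) x1(2) by (simp add: mult_pos_neg)
  then obtain m n where mn: "m \<in> sdual {x\<in>R. 0 \<le> z \<bullet> x}" "n \<in> sdual {x\<in>R. 0 \<le> z \<bullet> x}"
    "m \<bullet> n < - c" "sgn (m - (m \<bullet> n) *\<^sub>R n) \<in> R" "z \<bullet> sgn (m - (m \<bullet> n) *\<^sub>R n) = 0"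
    using cut_pair[OF y0(1) far[OF y0] x1(1)] by blast
  have "dist (g (sgn (m - (m \<bullet> n) *\<^sub>R n))) e < r"
    using far[OF mn(4)] mn(5) by fastforce
  moreover have "\<forall>y\<in>R. r \<le> dist (g y) e \<longrightarrow> 0 \<le> m \<bullet> y \<and> 0 \<le> n \<bullet> y"
  proof (intro ballI impI)
    fix y assume "y \<in> R" "r \<le> dist (g y) e"
    then have "y \<in> {x\<in>R. 0 \<le> z \<bullet> x}" using far by fastforce
    then show "0 \<le> m \<bullet> y \<and> 0 \<le> n \<bullet> y" using mn(1,2) sdualD by blast
  qed
  ultimately show thesis using that mn sdual_S2 by blast
qed

text \<open>Caps around \<open>e\<close> shrinking to a point give pairs \<open>m\<close>,
  \<open>n\<close> that subconverge. The limits are nonnegative on \<open>R\<close>, because each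
  point other than \<open>e\<close> is eventually left uncut, so their product is exactly
  \<open>- c\<close>; their side center is the limit of the cut centers, which is
  \<open>sgn e\<close>.\<close>

lemma extreme_mem_E:
  fixes d :: "real^3"
  defines "g \<equiv> \<lambda>x. (1 / (d \<bullet> x)) *\<^sub>R x"
  assumes d: "\<And>x. x \<in> R \<Longrightarrow> 0 < d \<bullet> x"
    and e: "e extreme_point_of (g ` R)" and cvx: "convex (g ` R)" and cpt: "compact (g ` R)"
  shows "sgn e \<in> E"
proof -
  have sgn_g: "sgn (g x) = x" if "x \<in> R" for x
    using d[OF that] S2_sgn[OF R_S2[OF that]] by (simp add: g_def sgn_scaleR)
  obtain x1 where x1: "x1 \<in> R" "e = g x1" using e unfolding extreme_point_of_def by blast
  then have eR: "sgn e = x1" using sgn_g by simp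
  have e0: "e \<noteq> 0" using d[OF x1(1)] x1(2) by (auto simp: g_def)
  obtain y0 where y0: "y0 \<in> R" "y0 \<noteq> x1" using R_not_singleton by blast
  then have "g y0 \<noteq> e" using sgn_g eR by metis
  \<comment> \<open>The radii never exceed the distance from \<open>e\<close> to
    \<open>g y0\<close>, so \<open>y0\<close> stays outside every cap and the cut body is not
    degenerate.\<close>
  define r where "r = (\<lambda>k. dist (g y0) e / real (Suc k))"
  have r0: "0 < r k" "r k \<le> dist (g y0) e" for k
    using \<open>g y0 \<noteq> e\<close> by (auto simp: r_def divide_le_eq mult_le_cancel_left1)
  have r_lim: "r \<longlonglongrightarrow> 0" unfolding r_def by (rule LIMSEQ_Suc) (rule lim_const_over_n)
  let ?x = "\<lambda>p :: (real^3) \<times> (real^3). sgn (fst p - (fst p \<bullet> snd p) *\<^sub>R snd p)"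
  have "\<exists>p. p \<in> S2 \<times> S2 \<and> fst p \<bullet> snd p < - c \<and> ?x p \<in> R \<and> dist (g (?x p)) e < r k \<and>
    (\<forall>y\<in>R. r k \<le> dist (g y) e \<longrightarrow> 0 \<le> fst p \<bullet> y \<and> 0 \<le> snd p \<bullet> y)" for k
  proof -
    obtain m n where "m \<in> S2" "n \<in> S2" "m \<bullet> n < - c" "sgn (m - (m \<bullet> n) *\<^sub>R n) \<in> R"
      "dist (g (sgn (m - (m \<bullet> n) *\<^sub>R n))) e < r k"
      "\<forall>y\<in>R. r k \<le> dist (g y) e \<longrightarrow> 0 \<le> m \<bullet> y \<and> 0 \<le> n \<bullet> y"
      using cap_pair[OF d e[unfolded g_def] cvx[unfolded g_def] cpt[unfolded g_def] y0(1)
          r0(2)[unfolded g_def] r0(1)] unfolding g_def by metis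
    then show ?thesis by (intro exI[of _ "(m, n)"]) simp
  qed
  then obtain p where p: "\<And>k. p k \<in> S2 \<times> S2" "\<And>k. fst (p k) \<bullet> snd (p k) < - c"
    "\<And>k. ?x (p k) \<in> R" "\<And>k. dist (g (?x (p k))) e < r k"
    "\<And>k y. y \<in> R \<Longrightarrow> r k \<le> dist (g y) e \<Longrightarrow> 0 \<le> fst (p k) \<bullet> y \<and> 0 \<le> snd (p k) \<bullet> y"
    by metis
  have "compact (S2 \<times> S2)" by (intro compact_Times compact_sphere)
  then obtain l h where l: "l \<in> S2 \<times> S2" and h: "strict_mono h" and lim: "(p \<circ> h) \<longlonglongrightarrow> l"
    using p(1) unfolding compact_def by metis
  obtain m n where mn: "l = (m, n)" by (cases l)
  have S: "m \<in> S2" "n \<in> S2" using l mn by auto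
  have lm: "(\<lambda>k. fst (p (h k))) \<longlonglongrightarrow> m" and ln: "(\<lambda>k. snd (p (h k))) \<longlonglongrightarrow> n"
    using tendsto_fst[OF lim] tendsto_snd[OF lim] mn by (simp_all add: o_def)
  have rh: "(\<lambda>k. r (h k)) \<longlonglongrightarrow> 0" using LIMSEQ_subseq_LIMSEQ[OF r_lim h] by (simp add: o_def)
  have "(\<lambda>k. dist (g (?x (p (h k)))) e) \<longlonglongrightarrow> 0"
    using less_imp_le[OF p(4)] by (intro tendsto_sandwich[OF _ _ tendsto_const rh]) simp_all
  then have "(\<lambda>k. g (?x (p (h k)))) \<longlonglongrightarrow> e" by (rule tendsto_dist_iff[THEN iffD2])
  then have "(\<lambda>k. sgn (g (?x (p (h k))))) \<longlonglongrightarrow> sgn e" using e0 by (rule tendsto_sgn)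
  then have lx: "(\<lambda>k. ?x (p (h k))) \<longlonglongrightarrow> sgn e" using sgn_g[OF p(3)] by simp
  \<comment> \<open>The point \<open>sgn e\<close> itself may be cut off every time. There the sign
    comes from the side centers \<open>?x (p k)\<close>, at which both normals are nonnegative by
    computation.\<close>
  have mne: "0 \<le> m \<bullet> sgn e \<and> 0 \<le> n \<bullet> sgn e"
  proof -
    have ge: "0 \<le> fst (p k) \<bullet> ?x (p k) \<and> 0 \<le> snd (p k) \<bullet> ?x (p k)" for k
    proof -
      have pS: "fst (p k) \<in> S2" "snd (p k) \<in> S2" using p(1)[of k] by (auto simp: mem_Times_iff)
      have "(fst (p k) \<bullet> snd (p k))\<^sup>2 \<le> 1"
        using S2_abs_inner[OF pS] by (simp add: abs_square_le_1)
      then show ?thesis using S2_inner_self[OF pS(1)] S2_inner_self[OF pS(2)]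
        by (simp add: inner_sgn_nonneg inner_diff_right inner_commute power2_eq_square)
    qed
    have "(\<lambda>k. fst (p (h k)) \<bullet> ?x (p (h k))) \<longlonglongrightarrow> m \<bullet> sgn e"
      "(\<lambda>k. snd (p (h k)) \<bullet> ?x (p (h k))) \<longlonglongrightarrow> n \<bullet> sgn e"
      by (intro tendsto_inner lm ln lx)+
    then show ?thesis using ge by (auto intro: LIMSEQ_le_const)
  qed
  have mnR: "0 \<le> m \<bullet> y \<and> 0 \<le> n \<bullet> y" if y: "y \<in> R" for y
  proof (cases "g y = e")
    case True
    then have "y = sgn e" using sgn_g[OF y] by simp
    then show ?thesis using mne by simp
  next
    case False
    then have "\<forall>\<^sub>F k in sequentially. r (h k) < dist (g y) e"
      using order_tendstoD(2)[OF rh] by simp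
    then have "\<forall>\<^sub>F k in sequentially. 0 \<le> fst (p (h k)) \<bullet> y \<and> 0 \<le> snd (p (h k)) \<bullet> y"
      by eventually_elim (use p(5)[OF y] in auto)
    then have ev: "\<forall>\<^sub>F k in sequentially. 0 \<le> fst (p (h k)) \<bullet> y" "\<forall>\<^sub>F k in sequentially. 0 \<le> snd (p (h k)) \<bullet> y"
      by (auto elim: eventually_mono)
    have "(\<lambda>k. fst (p (h k)) \<bullet> y) \<longlonglongrightarrow> m \<bullet> y" "(\<lambda>k. snd (p (h k)) \<bullet> y) \<longlonglongrightarrow> n \<bullet> y"
      by (intro tendsto_inner lm ln tendsto_const)+
    then show ?thesis using ev by (auto intro: tendsto_lowerbound)
  qed
  have mD: "m \<in> sdual R" and nD: "n \<in> sdual R" using mnR S by (auto simp: sdual_def)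
  have lmn: "(\<lambda>k. fst (p (h k)) \<bullet> snd (p (h k))) \<longlonglongrightarrow> m \<bullet> n"
    by (intro tendsto_inner lm ln)
  then have "m \<bullet> n \<le> - c" by (rule LIMSEQ_le_const2) (use p(2) less_imp_le in blast)
  then have mnc: "m \<bullet> n = - c" using sdual_inner_ge[OF mD nD] by simp
  have nrm: "norm (m + c *\<^sub>R n) = s" by (rule norm_center[OF S mnc])
  then have "m - (m \<bullet> n) *\<^sub>R n \<noteq> 0" using s_pos mnc by auto
  then have "(\<lambda>k. ?x (p (h k))) \<longlonglongrightarrow> sgn (m - (m \<bullet> n) *\<^sub>R n)"
    by (intro tendsto_intros lm ln)
  then have "sgn e = sgn (m - (m \<bullet> n) *\<^sub>R n)" using lx LIMSEQ_unique by blast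
  then have "sgn e = (1 / s) *\<^sub>R (m + c *\<^sub>R n)" using mnc nrm by (simp add: sgn_div_norm divide_inverse)
  then show ?thesis using E_I[OF mD nD mnc] by simp
qed

text \<open>By Krein-Milman the projected body is the hull of its extreme points, whose directions
  lie in \<open>E\<close>. Passing through the bidual of \<open>E\<close> absorbs the different
  scalings of these points.\<close>

lemma hull_E:
  assumes x: "x \<in> R"
  shows "\<exists>p\<in>convex hull E. p \<noteq> 0 \<and> x = sgn p"
proof -
  obtain d where d: "\<And>x. x \<in> R \<Longrightarrow> 0 < d \<bullet> x" using positive_functional by blast
  define g where "g = (\<lambda>x. (1 / (d \<bullet> x)) *\<^sub>R x)"
  have "continuous_on R g" unfolding g_def
    by (intro continuous_intros) (use d in fastforce)
  then have cpt: "compact (g ` R)" using sconvex_body_compact[OF body] by (rule compact_continuous_image)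
  have sc: "sconvex R" using body by (simp add: sconvex_body_def)
  have cvx: "convex (g ` R)"
  proof (rule convexI)
    fix x y and u v :: real
    assume xy: "x \<in> g ` R" "y \<in> g ` R" and uv: "0 \<le> u" "0 \<le> v" "u + v = 1"
    obtain a b where ab: "a \<in> R" "b \<in> R" "x = g a" "y = g b" using xy by blast
    \<comment> \<open>These weights recover the convex combination of the projected points from
      \<open>a\<close> and \<open>b\<close>, so that \<open>?w\<close> has value 1 under
      \<open>d\<close>.\<close>
    let ?s = "u / (d \<bullet> a)" and ?t = "v / (d \<bullet> b)"
    have da: "0 < d \<bullet> a" "0 < d \<bullet> b" using d ab by auto
    have st: "0 \<le> ?s" "0 \<le> ?t" "0 < ?s + ?t"
      using da uv by (auto simp: add_nonneg_pos add_pos_nonneg intro: add_nonneg_pos)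
        (cases "u = 0"; auto intro: add_pos_nonneg)+
    let ?w = "?s *\<^sub>R a + ?t *\<^sub>R b"
    have w: "?w \<noteq> 0" "sgn ?w \<in> R" using sconvex_comb[OF sc ab(1,2) st] by auto
    have dw: "d \<bullet> ?w = 1" using da uv by (simp add: inner_add_right)
    have "g (sgn ?w) = ?w" using w(1) dw by (simp add: g_def inner_sgn_right norm_scaleR_sgn)
    moreover have "u *\<^sub>R x + v *\<^sub>R y = ?w" by (simp add: ab g_def)
    ultimately show "u *\<^sub>R x + v *\<^sub>R y \<in> g ` R" using w(2) by (metis image_eqI)
  qed
  have ext: "sgn e \<in> E" if "e extreme_point_of (g ` R)" for e
    using extreme_mem_E[OF d] that cvx cpt unfolding g_def by blast
  have "x \<in> sdual (sdual E)"
  proof -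
    have "0 \<le> m \<bullet> x" if m: "m \<in> sdual E" for m
    proof -
      have "0 \<le> m \<bullet> e" if "e extreme_point_of (g ` R)" for e
        using sdualD[OF m ext[OF that]] by (simp add: inner_sgn_nonneg)
      then have "0 \<le> m \<bullet> q" if "q \<in> convex hull {e. e extreme_point_of (g ` R)}" for q
        using inner_convex_hull_ge[OF _ that, of 0 m] by blast
      moreover have "g x \<in> convex hull {e. e extreme_point_of (g ` R)}"
        using Krein_Milman_Minkowski[OF cpt cvx] x by blast
      ultimately have "0 \<le> m \<bullet> g x" by blast
      then show ?thesis using d[OF x] by (simp add: g_def zero_le_divide_iff)
    qed
    then show ?thesis using R_S2[OF x] by (simp add: sdual_def inner_commute)
  qed
  moreover have "0 \<notin> convex hull E"
    using sconvex_hull_nonzero[OF body] hull_mono[OF E_subset, of convex] by blast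
  ultimately show ?thesis using farkas_sphere[OF compact_E] by blast
qed

lemma R_inner_ge:
  assumes "0 \<le> \<kappa>" "\<And>a b. a \<in> E \<Longrightarrow> b \<in> E \<Longrightarrow> \<kappa> \<le> a \<bullet> b" "x \<in> R" "y \<in> R"
  shows "\<kappa> \<le> x \<bullet> y"
proof -
  obtain p q where "p \<in> convex hull E" "p \<noteq> 0" "x = sgn p" "q \<in> convex hull E" "q \<noteq> 0" "y = sgn q"
    using hull_E assms(3,4) by metis
  moreover have "E \<subseteq> S2" using E_subset R_S2 by blast
  ultimately show ?thesis using inner_sgn_hull_ge[OF assms(1) _ assms(2)] by blast
qed

text \<open>A point \<open>z\<close> violating this cuts \<open>R\<close> properly, and the dual of
  the cut body is generated by \<open>sdual R\<close> and \<open>z\<close>. All products of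
  generators are at least \<open>- c\<close>, which is nonnegative here, so the same holds for the
  whole dual, against \<open>cut_pair\<close>.\<close>

lemma complete:
  assumes c0: "c \<le> 0" and z: "z \<in> S2" "\<And>y. y \<in> sdual R \<Longrightarrow> - c \<le> y \<bullet> z"
  shows "z \<in> sdual R"
proof (rule ccontr)
  assume "z \<notin> sdual R"
  then obtain x1 where x1: "x1 \<in> R" "z \<bullet> x1 < 0" using z(1) by (force simp: sdual_def)
  have "- z \<notin> sdual R" using z(2)[of "-z"] S2_inner_self[OF z(1)] c_bounds c0 by auto
  then obtain x0 where x0: "x0 \<in> R" "0 < z \<bullet> x0" using z(1) by (force simp: sdual_def)
  let ?Z = "{x\<in>R. 0 \<le> z \<bullet> x}" and ?A = "insert z (sdual R)"
  obtain m n where mn: "m \<in> sdual ?Z" "n \<in> sdual ?Z" "m \<bullet> n < - c"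
    using cut_pair[OF x0 x1] by blast
  have Z: "sconvex_body ?Z" by (rule sconvex_body_cut[OF body x0])
  have A: "?A \<subseteq> sdual ?Z" using z(1) by (auto simp: sdual_def)
  obtain i where i: "\<And>m. m \<in> sdual ?Z \<Longrightarrow> 0 < m \<bullet> i"
    using sconvex_body_interior_point[OF Z] by blast
  have cA: "compact ?A" using compact_sdual by simp
  have nz: "0 \<notin> convex hull ?A"
  proof
    assume 0: "0 \<in> convex hull ?A"
    have "0 < i \<bullet> a" if "a \<in> ?A" for a
      using i[of a] A that by (subst inner_commute) blast
    then have "convex hull ?A \<subseteq> {p. i \<bullet> p > 0}"
      by (intro hull_minimal convex_halfspace_gt) blast
    then show False using 0 by auto
  qed
  have "sdual ?A \<subseteq> ?Z"
  proof
    fix y assume y: "y \<in> sdual ?A"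
    then have "y \<in> sdual (sdual R)" by (auto simp: sdual_def)
    then have "y \<in> R" using sdual_sdual[OF body] by simp
    then show "y \<in> ?Z" using sdualD[OF y, of z] by (simp add: inner_commute)
  qed
  then have sub: "v \<in> sdual (sdual ?A)" if "v \<in> sdual ?Z" for v
    using that unfolding sdual_def[of "sdual ?A"] sdual_def[of ?Z] by blast
  obtain p where p: "p \<in> convex hull ?A" "p \<noteq> 0" "m = sgn p"
    using farkas_sphere[OF cA nz sub[OF mn(1)]] by blast
  obtain q where q: "q \<in> convex hull ?A" "q \<noteq> 0" "n = sgn q"
    using farkas_sphere[OF cA nz sub[OF mn(2)]] by blast
  have "- c \<le> a \<bullet> b" if "a \<in> ?A" "b \<in> ?A" for a b
    using that sdual_inner_ge z(2) S2_inner_self[OF z(1)] c_bounds by (auto simp: inner_commute)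
  moreover have "?A \<subseteq> S2" using z(1) sdual_S2 by blast
  ultimately have "- c \<le> m \<bullet> n"
    using inner_sgn_hull_ge[of "-c" ?A p q] p q c0 by simp
  then show False using mn(3) by simp
qed

subsection \<open>Thickness less than a right angle\<close>

text \<open>One statement serves both the bound and its equality case. Testing each lune against the
  contact points of the other gives the scalar inequalities, which leave only equality; then the two
  opposite centers have product 1 and coincide in \<open>p\<close>.\<close>

lemma E_pair:
  assumes c0: "0 < c" and ab: "a \<in> E" "b \<in> E" and le: "a \<bullet> b \<le> c * c"
  obtains p u v where "a \<bullet> b = c * c" "p \<in> R" "u \<in> sdual R" "v \<in> sdual R"
    "p \<bullet> u = 0" "p \<bullet> v = 0" "u \<bullet> v = 0"
    "s *\<^sub>R p - c *\<^sub>R u \<in> sdual R" "s *\<^sub>R p - c *\<^sub>R v \<in> sdual R"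
    "a = c *\<^sub>R p + s *\<^sub>R u" "b = c *\<^sub>R p + s *\<^sub>R v"
proof -
  have R: "a \<in> R" "b \<in> R" using ab E_subset by auto
  obtain m1 where m1: "m1 \<in> sdual R" "m1 \<bullet> a = 0" "s *\<^sub>R a - c *\<^sub>R m1 \<in> sdual R"
    using ab(1) by (auto simp: E_def)
  obtain m2 where m2: "m2 \<in> sdual R" "m2 \<bullet> b = 0" "s *\<^sub>R b - c *\<^sub>R m2 \<in> sdual R"
    using ab(2) by (auto simp: E_def)
  have S: "a \<in> S2" "b \<in> S2" "m1 \<in> S2" "m2 \<in> S2" using R R_S2 m1 m2 sdual_S2 by blast+
  note sq = S[THEN S2_inner_self]
  have am: "a \<bullet> m1 = 0" "b \<bullet> m2 = 0" using m1 m2 by (simp_all add: inner_commute)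
  \<comment> \<open>This is the center of the other side of the lune, rewritten with
    \<open>n = s *\<^sub>R a - c *\<^sub>R m\<close>.\<close>
  have q: "c *\<^sub>R a + s *\<^sub>R m \<in> R"
    if "m \<in> sdual R" "m \<bullet> a = 0" "s *\<^sub>R a - c *\<^sub>R m \<in> sdual R" for a m
  proof -
    have "m \<bullet> (s *\<^sub>R a - c *\<^sub>R m) = - c"
      using that S2_inner_self[OF sdual_S2[OF that(1)]] by (simp add: inner_diff_right)
    then have "(1 / s) *\<^sub>R (m + c *\<^sub>R (s *\<^sub>R a - c *\<^sub>R m)) \<in> R" using center_mem that by blast
    moreover have "m + c *\<^sub>R (s *\<^sub>R a - c *\<^sub>R m) = s *\<^sub>R (c *\<^sub>R a + s *\<^sub>R m)"
    proof -
      have "m = (c * c + s * s) *\<^sub>R m" using c2_s2 by simp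
      then have "m + c *\<^sub>R (s *\<^sub>R a - c *\<^sub>R m) = (c * c + s * s) *\<^sub>R m + c *\<^sub>R (s *\<^sub>R a - c *\<^sub>R m)" by simp
      then show ?thesis by (simp add: scaleR_add_left scaleR_add_right scaleR_diff_right mult.commute)
    qed
    ultimately show ?thesis using s_pos by simp
  qed
  have q1: "c *\<^sub>R a + s *\<^sub>R m1 \<in> R" and q2: "c *\<^sub>R b + s *\<^sub>R m2 \<in> R" using q m1 m2 by blast+
  define k X Y M where "k = a \<bullet> b" and "X = b \<bullet> m1" and "Y = a \<bullet> m2" and "M = m1 \<bullet> m2"
  note defs = k_def X_def Y_def M_def
  have X0: "0 \<le> X" and Y0: "0 \<le> Y"
    using sdualD[OF m1(1) R(2)] sdualD[OF m2(1) R(1)] by (simp_all add: defs inner_commute)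
  have Xk: "c * X \<le> s * k" and Yk: "c * Y \<le> s * k"
    using sdualD[OF m1(3) R(2)] sdualD[OF m2(3) R(1)]
    by (simp_all add: defs inner_diff_left inner_diff_right inner_commute)
  have d1: "0 \<le> c * Y + s * M" and d2: "0 \<le> c * X + s * M"
    using sdualD[OF m2(1) q1] sdualD[OF m1(1) q2]
    by (simp_all add: defs inner_add_right inner_commute)
  have d3: "0 \<le> s * (c * k + s * X) - c * (c * Y + s * M)"
    using sdualD[OF m2(3) q1] by (simp add: defs inner_diff_left inner_add_right inner_diff_right inner_commute algebra_simps)
  have d4: "0 \<le> s * (c * k + s * Y) - c * (c * X + s * M)"
    using sdualD[OF m1(3) q2] by (simp add: defs inner_diff_left inner_add_right inner_diff_right inner_commute algebra_simps)
  have "0 \<le> c * X" using X0 c0 by simp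
  then have "0 \<le> s * k" using Xk by linarith
  then have k0: "0 \<le> k" using s_pos by (simp add: zero_le_mult_iff)
  have "0 < s * s" using s_pos by simp
  then have "k < 1" using le c2_s2 by (simp add: k_def)
  then have "k * k < 1 * 1" using k0 by (intro mult_strict_mono') auto
  then have kk: "(a \<bullet> b) * (a \<bullet> b) < 1" by (simp add: k_def)
  define w where "w = 1 - k * k"
  obtain \<mu>1 \<mu>2 where g: "w * M + k * X * Y = w * \<mu>1 * \<mu>2"
      "w * (\<mu>1 * \<mu>1) = w - X * X" "w * (\<mu>2 * \<mu>2) = w - Y * Y"
    using gram_frame[OF S m1(2) m2(2) kk w_def[unfolded k_def]] unfolding defs by metis
  \<comment> \<open>The scalar lemma assumes \<open>X \<le> Y\<close>; otherwise the two lunes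
    exchange roles.\<close>
  have core: "k = c * c \<and> X = s * c \<and> Y = s * c \<and> M = s * s"
  proof (cases "X \<le> Y")
    case True
    show ?thesis
      using pair_scalar_core[OF c0 s_pos c2_s2 le[folded k_def] w_def X0 True Yk g d2 d3] .
  next
    case False
    have g': "w * M + k * Y * X = w * \<mu>2 * \<mu>1" using g(1) by (simp add: mult.commute mult.left_commute)
    show ?thesis
      using pair_scalar_core[OF c0 s_pos c2_s2 le[folded k_def] w_def Y0 _ Xk g' g(3,2) d1 d4] False
      by auto
  qed
  then have v: "a \<bullet> b = c * c" "b \<bullet> m1 = s * c" "a \<bullet> m2 = s * c" "m1 \<bullet> m2 = s * s"
    by (simp_all add: defs)
  have v': "b \<bullet> a = c * c" "m1 \<bullet> b = s * c" "m2 \<bullet> a = s * c" "m2 \<bullet> m1 = s * s"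
    using v by (simp_all add: inner_commute)
  let ?p = "c *\<^sub>R a + s *\<^sub>R m1" and ?u = "s *\<^sub>R a - c *\<^sub>R m1" and ?v = "s *\<^sub>R b - c *\<^sub>R m2"
  have "?p \<bullet> (c *\<^sub>R b + s *\<^sub>R m2) = (c * c + s * s) * (c * c + s * s)"
    using v v' by (simp add: inner_add_left inner_add_right algebra_simps)
  then have p2: "c *\<^sub>R b + s *\<^sub>R m2 = ?p"
    using S2_inner_eq_1[OF R_S2[OF q1] R_S2[OF q2]] c2_s2 by simp
  \<comment> \<open>The map taking \<open>x\<close>, \<open>y\<close> to \<open>c x + s y\<close>,
    \<open>s x - c y\<close> is an involution, so \<open>a\<close> and \<open>m1\<close> are
    recovered from \<open>?p\<close> and \<open>?u\<close> by the same formula.\<close>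
  have rot: "c *\<^sub>R (c *\<^sub>R x + s *\<^sub>R y) + s *\<^sub>R (s *\<^sub>R x - c *\<^sub>R y) = x"
    "s *\<^sub>R (c *\<^sub>R x + s *\<^sub>R y) - c *\<^sub>R (s *\<^sub>R x - c *\<^sub>R y) = y" for x y :: "real^3"
  proof -
    have "c *\<^sub>R (c *\<^sub>R x + s *\<^sub>R y) + s *\<^sub>R (s *\<^sub>R x - c *\<^sub>R y) = (c * c + s * s) *\<^sub>R x"
      "s *\<^sub>R (c *\<^sub>R x + s *\<^sub>R y) - c *\<^sub>R (s *\<^sub>R x - c *\<^sub>R y) = (c * c + s * s) *\<^sub>R y"
      by (simp_all add: scaleR_add_left scaleR_add_right scaleR_diff_right mult.commute)
    then show "c *\<^sub>R (c *\<^sub>R x + s *\<^sub>R y) + s *\<^sub>R (s *\<^sub>R x - c *\<^sub>R y) = x"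
      "s *\<^sub>R (c *\<^sub>R x + s *\<^sub>R y) - c *\<^sub>R (s *\<^sub>R x - c *\<^sub>R y) = y" using c2_s2 by simp_all
  qed
  show thesis
  proof (rule that[OF v(1) q1 m1(3) m2(3)])
    show "?p \<bullet> ?u = 0" using sq am m1(2) by (simp add: inner_add_left inner_diff_right)
    have "(c *\<^sub>R b + s *\<^sub>R m2) \<bullet> ?v = 0" using sq am m2(2) by (simp add: inner_add_left inner_diff_right)
    then show "?p \<bullet> ?v = 0" using p2 by simp
    show "?u \<bullet> ?v = 0" using v v' by (simp add: inner_diff_left inner_diff_right algebra_simps)
    show "s *\<^sub>R ?p - c *\<^sub>R ?u \<in> sdual R" using m1(1) rot(2) by simp
    show "s *\<^sub>R ?p - c *\<^sub>R ?v \<in> sdual R" using m2(1) rot(2)[of b m2] p2 by simp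
    show "a = c *\<^sub>R ?p + s *\<^sub>R ?u" using rot(1) by simp
    show "b = c *\<^sub>R ?p + s *\<^sub>R ?v" using rot(1)[of b m2] p2 by simp
  qed
qed

lemma E_inner_ge: "0 < c \<Longrightarrow> a \<in> E \<Longrightarrow> b \<in> E \<Longrightarrow> c * c \<le> a \<bullet> b"
  using E_pair[of a b] by (metis linear order_refl)

text \<open>One inclusion: every generator in \<open>E\<close> is within the thickness of
  \<open>p\<close>. The other: for each direction \<open>f\<close> between \<open>u\<close> and
  \<open>v\<close> the end \<open>c *\<^sub>R p + s *\<^sub>R f\<close> of the radius is a side
  center and so lies in \<open>R\<close>, and these radii fill the quarter.\<close>

lemma quarter:
  assumes c0: "0 < c" and ab: "a \<in> E" "b \<in> E" "a \<bullet> b = c * c"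
  obtains p u v where "p \<in> S2" "u \<in> S2" "v \<in> S2" "p \<bullet> u = 0" "p \<bullet> v = 0" "u \<bullet> v = 0"
    "R = {x \<in> S2. c \<le> p \<bullet> x \<and> 0 \<le> x \<bullet> u \<and> 0 \<le> x \<bullet> v}"
proof -
  obtain p u v where p: "p \<in> R" and u: "u \<in> sdual R" and v: "v \<in> sdual R"
    and o: "p \<bullet> u = 0" "p \<bullet> v = 0" "u \<bullet> v = 0"
    and pu: "s *\<^sub>R p - c *\<^sub>R u \<in> sdual R" and pv: "s *\<^sub>R p - c *\<^sub>R v \<in> sdual R"
    and a: "a = c *\<^sub>R p + s *\<^sub>R u" and b: "b = c *\<^sub>R p + s *\<^sub>R v"
    using E_pair[OF c0 ab(1,2) eq_refl[OF ab(3)]] by metis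
  have R: "a \<in> R" "b \<in> R" using ab E_subset by auto
  have S: "p \<in> S2" "u \<in> S2" "v \<in> S2" using p u v R_S2 sdual_S2 by blast+
  note sq = S[THEN S2_inner_self]
  have o': "u \<bullet> p = 0" "v \<bullet> p = 0" "v \<bullet> u = 0" using o by (simp_all add: inner_commute)
  note ex = orthonormal_expand(2)[OF S(2,3,1) o(3) o'(1,2)]
  have Ep: "c \<le> p \<bullet> e" if e: "e \<in> E" for e
  proof -
    obtain m where m: "m \<in> sdual R" "m \<bullet> e = 0" and n: "s *\<^sub>R e - c *\<^sub>R m \<in> sdual R"
      using e by (auto simp: E_def)
    have eR: "e \<in> R" using e E_subset by blast
    \<comment> \<open>The sign conditions on \<open>m\<close> and on the opposite side center become
      bounds on \<open>n\<close>, so that only \<open>e\<close> and \<open>n\<close> enter the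
      scalar lemma.\<close>
    define n where "n = s *\<^sub>R e - c *\<^sub>R m"
    have nD: "n \<in> sdual R" using n by (simp add: n_def)
    have cm: "c *\<^sub>R m = s *\<^sub>R e - n" by (simp add: n_def)
    have mx: "n \<bullet> x \<le> s * (e \<bullet> x)" if "x \<in> R" for x
    proof -
      have "0 \<le> c * (m \<bullet> x)" using sdualD[OF m(1) that] c0 by simp
      then have "0 \<le> (c *\<^sub>R m) \<bullet> x" by simp
      then show ?thesis unfolding cm by (simp add: inner_diff_left)
    qed
    have ne: "n \<bullet> e = s" using m(2) S2_inner_self[OF R_S2[OF eR]] by (simp add: n_def inner_diff_left)
    have mn: "m \<bullet> n = - c"
      using m S2_inner_self[OF sdual_S2[OF m(1)]] by (simp add: n_def inner_diff_right)
    have qR: "(1 / s) *\<^sub>R (m + c *\<^sub>R n) \<in> R" using center_mem[OF m(1) nD mn] .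
    have qx: "s * (n \<bullet> x) \<le> e \<bullet> x" if "x \<in> sdual R" for x
    proof -
      have "0 \<le> x \<bullet> ((1 / s) *\<^sub>R (m + c *\<^sub>R n))" using sdualD[OF that qR] .
      then have "0 \<le> (m + c *\<^sub>R n) \<bullet> x" using s_pos by (simp add: inner_commute zero_le_divide_iff)
      then have "0 \<le> c * ((m + c *\<^sub>R n) \<bullet> x)" using c0 by simp
      also have "\<dots> = (c *\<^sub>R m) \<bullet> x + c * c * (n \<bullet> x)" by (simp add: inner_add_left algebra_simps)
      also have "\<dots> = s * (e \<bullet> x) - (1 - c * c) * (n \<bullet> x)"
        unfolding cm by (simp add: inner_diff_left algebra_simps)
      also have "1 - c * c = s * s" using c2_s2 by simp
      finally have "s * (s * (n \<bullet> x)) \<le> s * (e \<bullet> x)" by (simp add: algebra_simps)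
      then show ?thesis using s_pos by simp
    qed
    have "c \<le> e \<bullet> p"
    proof (rule quarter_scalar_core[OF c0 s_pos c2_s2])
      show "0 \<le> e \<bullet> u" "0 \<le> e \<bullet> v" using sdualD[OF u eR] sdualD[OF v eR] by (simp_all add: inner_commute)
      show "c * (e \<bullet> u) \<le> s * (e \<bullet> p)" "c * (e \<bullet> v) \<le> s * (e \<bullet> p)"
        using sdualD[OF pu eR] sdualD[OF pv eR]
        by (simp_all add: inner_diff_left inner_diff_right inner_commute)
      show "(e \<bullet> u) * (e \<bullet> u) + (e \<bullet> v) * (e \<bullet> v) + (e \<bullet> p) * (e \<bullet> p) = 1"
        using ex[of e e] S2_inner_self[OF R_S2[OF eR]] by simp
      show "(n \<bullet> u) * (n \<bullet> u) + (n \<bullet> v) * (n \<bullet> v) + (n \<bullet> p) * (n \<bullet> p) = 1"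
        using ex[of n n] S2_inner_self[OF sdual_S2[OF nD]] by simp
      show "(e \<bullet> u) * (n \<bullet> u) + (e \<bullet> v) * (n \<bullet> v) + (e \<bullet> p) * (n \<bullet> p) = s"
        using ex[of e n] ne by (simp add: inner_commute)
      show "0 \<le> n \<bullet> p" using sdualD[OF nD p] .
      show "n \<bullet> p \<le> s * (e \<bullet> p)" using mx[OF p] .
      show "s * (n \<bullet> u) \<le> e \<bullet> u" "s * (n \<bullet> v) \<le> e \<bullet> v" using qx u v by blast+
      show "s * (n \<bullet> u) + c * (n \<bullet> p) \<le> s * (s * (e \<bullet> u) + c * (e \<bullet> p))"
        using mx[OF R(1)] by (simp add: a inner_add_right algebra_simps)
      show "s * (n \<bullet> v) + c * (n \<bullet> p) \<le> s * (s * (e \<bullet> v) + c * (e \<bullet> p))"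
        using mx[OF R(2)] by (simp add: b inner_add_right algebra_simps)
    qed
    then show ?thesis by (simp add: inner_commute)
  qed
  have Rp: "c \<le> p \<bullet> x" if x: "x \<in> R" for x
  proof -
    obtain y where y: "y \<in> convex hull E" "y \<noteq> 0" "x = sgn y" using hull_E[OF x] by blast
    have py: "c \<le> p \<bullet> y" using inner_convex_hull_ge[OF Ep y(1)] by blast
    have "convex hull E \<subseteq> cball 0 1"
      using E_subset R_S2 by (intro hull_minimal) (force simp: convex_cball)+
    then have "norm y \<le> 1" using y by auto
    then have "c * norm y \<le> c" using c0 by (intro mult_left_le) auto
    then have "c * norm y \<le> p \<bullet> y" using py by linarith
    then show ?thesis using y by (simp add: inner_sgn_right pos_le_divide_eq)
  qed
  let ?Q = "{x \<in> S2. c \<le> p \<bullet> x \<and> 0 \<le> x \<bullet> u \<and> 0 \<le> x \<bullet> v}"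
  have "R \<subseteq> ?Q"
    using Rp R_S2 sdualD[OF u] sdualD[OF v] by (auto simp: inner_commute)
  moreover have "x \<in> R" if xS: "x \<in> S2" and x: "c \<le> p \<bullet> x" "0 \<le> x \<bullet> u" "0 \<le> x \<bullet> v" for x
  proof -
    have one: "(x \<bullet> u) * (x \<bullet> u) + (x \<bullet> v) * (x \<bullet> v) = 1 - (x \<bullet> p) * (x \<bullet> p)"
      using ex[of x x] S2_inner_self[OF xS] by simp
    define y where "y = (x \<bullet> u) *\<^sub>R u + (x \<bullet> v) *\<^sub>R v"
    have xy: "x = y + (x \<bullet> p) *\<^sub>R p"
      using orthonormal_expand(1)[OF S(2,3,1) o(3) o'(1,2), of x] by (simp add: y_def)
    have yy: "y \<bullet> y = 1 - (x \<bullet> p) * (x \<bullet> p)"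
      using one sq o o' by (simp add: y_def inner_add_left inner_add_right)
    have yp: "y \<bullet> p = 0" using o' by (simp add: y_def inner_add_left)
    show ?thesis
    proof (cases "y = 0")
      case True
      then have "x = (x \<bullet> p) *\<^sub>R p" using xy by simp
      moreover have "x \<bullet> p = 1"
      proof -
        have "(x \<bullet> p)\<^sup>2 = 1" using yy True by (simp add: power2_eq_square)
        then show ?thesis using x(1) c0 by (auto simp: power2_eq_1_iff inner_commute)
      qed
      ultimately show ?thesis using p by simp
    next
      case False
      define f where "f = sgn y"
      have fD: "f \<in> sdual R"
        unfolding f_def y_def using False by (intro sdual_comb u v x) (simp add: y_def)
      have fS: "f \<in> S2" using fD sdual_S2 by blast
      have pf: "p \<bullet> f = 0" using yp by (simp add: f_def inner_sgn_right inner_commute)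
      \<comment> \<open>The circle bounding this hemisphere passes through
        \<open>c *\<^sub>R p + s *\<^sub>R f\<close>. It contains \<open>R\<close> because
        \<open>R\<close> lies in the disk around \<open>p\<close>, and its product with
        \<open>f\<close> is \<open>- c\<close>.\<close>
      define m where "m = s *\<^sub>R p - c *\<^sub>R f"
      have "m \<bullet> m = 1" using sq S2_inner_self[OF fS] pf c2_s2
        by (simp add: m_def inner_diff_left inner_diff_right inner_commute)
      moreover have "0 \<le> m \<bullet> r" if r: "r \<in> R" for r
      proof -
        have "norm (r - (p \<bullet> r) *\<^sub>R p) = sqrt (1 - (p \<bullet> r)\<^sup>2)"
          using norm_orth_part[OF S(1) R_S2[OF r]] by (simp add: norm_eq_sqrt_inner)
        also have "\<dots> \<le> sqrt (s\<^sup>2)"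
        proof (rule real_sqrt_le_mono)
          have "c * c \<le> (p \<bullet> r) * (p \<bullet> r)" using Rp[OF r] c0 by (intro mult_mono) auto
          then show "1 - (p \<bullet> r)\<^sup>2 \<le> s\<^sup>2" using c2_s2 by (simp add: power2_eq_square)
        qed
        finally have "norm (r - (p \<bullet> r) *\<^sub>R p) \<le> s" using s_pos by simp
        moreover have "f \<bullet> r = f \<bullet> (r - (p \<bullet> r) *\<^sub>R p)"
          using pf by (simp add: inner_diff_right inner_commute)
        moreover have "f \<bullet> (r - (p \<bullet> r) *\<^sub>R p) \<le> norm (r - (p \<bullet> r) *\<^sub>R p)"
          using norm_cauchy_schwarz[of f "r - (p \<bullet> r) *\<^sub>R p"] fS by simp
        ultimately have "c * (f \<bullet> r) \<le> c * s" using c0 by simp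
        also have "\<dots> \<le> s * (p \<bullet> r)" using Rp[OF r] s_pos by (simp add: mult.commute)
        finally show ?thesis by (simp add: m_def inner_diff_left)
      qed
      ultimately have mD: "m \<in> sdual R" using S2_I[of m] by (simp add: sdual_def del: mem_sphere_0)
      have "f \<bullet> m = - c" using pf S2_inner_self[OF fS] by (simp add: m_def inner_diff_right inner_commute)
      then have "(1 / s) *\<^sub>R (f + c *\<^sub>R m) \<in> R" using center_mem[OF fD mD] by blast
      moreover have "f + c *\<^sub>R m = s *\<^sub>R (c *\<^sub>R p + s *\<^sub>R f)"
      proof -
        have "f + c *\<^sub>R m = (c * c + s * s) *\<^sub>R f + c *\<^sub>R m" using c2_s2 by simp
        then show ?thesis
          by (simp add: m_def scaleR_add_left scaleR_add_right scaleR_diff_right mult.commute)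
      qed
      ultimately have z: "c *\<^sub>R p + s *\<^sub>R f \<in> R" using s_pos by simp
      have ny: "0 < norm y" using False by simp
      have nle: "c * norm y \<le> s * (p \<bullet> x)"
      proof -
        have "(norm y)\<^sup>2 = 1 - (p \<bullet> x) * (p \<bullet> x)" using yy by (simp add: power2_norm_eq_inner inner_commute)
        moreover have "c * c \<le> (p \<bullet> x) * (p \<bullet> x)" using x c0 by (intro mult_mono) auto
        ultimately have "(norm y)\<^sup>2 \<le> s\<^sup>2" using c2_s2 by (simp add: power2_eq_square)
        then have "norm y \<le> s" using s_pos by (intro power2_le_imp_le[of "norm y" s]) simp_all
        then have "c * norm y \<le> (p \<bullet> x) * s" using x c0 by (intro mult_mono) auto
        then show ?thesis by (simp add: mult.commute)
      qed
      \<comment> \<open>These coefficients solve for \<open>x\<close> in terms of \<open>p\<close>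
        and the end of the radius; \<open>nle\<close> says that the first is nonnegative.\<close>
      let ?\<alpha> = "p \<bullet> x - c * norm y / s" and ?\<beta> = "norm y / s"
      have ab0: "0 \<le> ?\<alpha>" "0 < ?\<beta>" using nle ny s_pos by (simp_all add: divide_le_eq mult.commute)
      have "x = ?\<alpha> *\<^sub>R p + ?\<beta> *\<^sub>R (c *\<^sub>R p + s *\<^sub>R f)"
      proof -
        have "norm y *\<^sub>R f = y" by (simp add: f_def norm_scaleR_sgn)
        then have *: "?\<alpha> *\<^sub>R p + ?\<beta> *\<^sub>R (c *\<^sub>R p + s *\<^sub>R f) = y + (p \<bullet> x) *\<^sub>R p"
          using s_pos by (simp add: scaleR_add_right scaleR_diff_left mult.commute)
        show ?thesis unfolding * using xy unfolding inner_commute[of x p] .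
      qed
      moreover have "sgn (?\<alpha> *\<^sub>R p + ?\<beta> *\<^sub>R (c *\<^sub>R p + s *\<^sub>R f)) \<in> R"
        using sconvex_comb[OF _ p z ab0(1)] ab0 body by (simp add: sconvex_body_def add_nonneg_pos)
      ultimately show ?thesis using S2_sgn[OF xS] by metis
    qed
  qed
  ultimately have "R = ?Q" by blast
  then show thesis using that S o by blast
qed

subsection \<open>Thickness at least a right angle\<close>

text \<open>Since \<open>d\<close> supports \<open>R\<close> at \<open>a\<close>, the perturbation \<open>d + h w - h\<^sup>2 a\<close> leaves the dual body for every
  \<open>h > 0\<close>, so completeness provides a far point for it; the limit \<open>h \<rightarrow> 0\<close> yields \<open>e\<close>.\<close>

lemma wide_far_point:
  assumes c0: "c \<le> 0" and d: "d \<in> sdual R" and a: "a \<in> R" "d \<bullet> a = 0"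
    and w: "w \<in> S2" "w \<bullet> d = 0" "w \<bullet> a = 0"
  obtains e where "e \<in> sdual R" "e \<bullet> d = - c" "w \<bullet> e \<le> 0"
proof -
  have S: "d \<in> S2" "a \<in> S2" using d a sdual_S2 R_S2 by blast+
  define h where "h = (\<lambda>k. 1 / real (Suc k))"
  have h0: "0 < h k" for k by (simp add: h_def)
  have hlim: "h \<longlonglongrightarrow> 0" unfolding h_def by (rule LIMSEQ_Suc) (rule lim_const_over_n)
  \<comment> \<open>This is the norm of the perturbed vector, since \<open>d\<close>,
    \<open>w\<close> and \<open>a\<close> are orthonormal.\<close>
  define t where "t = (\<lambda>k. sqrt (1 + (h k)\<^sup>2 + (h k)^4))"
  have ex: "\<exists>e\<in>sdual R. e \<bullet> d + h k * (e \<bullet> w) - (h k)\<^sup>2 * (e \<bullet> a) < - c * t k" for k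
  proof -
    let ?z = "d + h k *\<^sub>R w - (h k)\<^sup>2 *\<^sub>R a"
    have "?z \<bullet> ?z = 1 + (h k)\<^sup>2 + (h k)^4"
      using S[THEN S2_inner_self] S2_inner_self[OF w(1)] a(2) w(2,3)
      by (simp add: inner_add_left inner_add_right inner_diff_left inner_diff_right inner_commute
          power2_eq_square power4_eq_xxxx)
    then have nz: "norm ?z = t k" by (simp add: t_def norm_eq_sqrt_inner)
    have "0 < t k" by (simp add: t_def add_pos_nonneg)
    then have z0: "?z \<noteq> 0" using nz by auto
    have "?z \<bullet> a < 0"
      using h0[of k] S2_inner_self[OF S(2)] a(2) w(3) by (simp add: inner_add_left inner_diff_left)
    then have "sgn ?z \<notin> sdual R"
      using sdualD[OF _ a(1), of "sgn ?z"] by (auto simp: inner_sgn_nonneg_left)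
    then obtain e where e: "e \<in> sdual R" "e \<bullet> sgn ?z < - c"
      using complete[OF c0 sgn_S2[OF z0]] by force
    then have "e \<bullet> ?z < - c * t k"
      using \<open>0 < t k\<close> by (simp add: inner_sgn_right nz pos_divide_less_eq)
    moreover have "e \<bullet> ?z = e \<bullet> d + h k * (e \<bullet> w) - (h k)\<^sup>2 * (e \<bullet> a)"
      by (simp add: inner_add_right inner_diff_right)
    ultimately show ?thesis using e by auto
  qed
  then obtain e where e: "\<And>k. e k \<in> sdual R"
    "\<And>k. e k \<bullet> d + h k * (e k \<bullet> w) - (h k)\<^sup>2 * (e k \<bullet> a) < - c * t k" by metis
  obtain l r where l: "l \<in> sdual R" and r: "strict_mono r" and lim: "(e \<circ> r) \<longlonglongrightarrow> l"
    using compact_sdual[of R] e(1) unfolding compact_def by metis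
  have le: "(\<lambda>k. e (r k)) \<longlonglongrightarrow> l" using lim by (simp add: o_def)
  have hr: "(\<lambda>k. h (r k)) \<longlonglongrightarrow> 0" using LIMSEQ_subseq_LIMSEQ[OF hlim r] by (simp add: o_def)
  have tr: "(\<lambda>k. t (r k)) \<longlonglongrightarrow> 1"
  proof -
    have "(\<lambda>k. sqrt (1 + (h (r k))\<^sup>2 + (h (r k))^4)) \<longlonglongrightarrow> sqrt (1 + 0\<^sup>2 + 0^4)"
      by (intro tendsto_intros hr)
    then show ?thesis by (simp add: t_def)
  qed
  have "(\<lambda>k. e (r k) \<bullet> d + h (r k) * (e (r k) \<bullet> w) - (h (r k))\<^sup>2 * (e (r k) \<bullet> a))
      \<longlonglongrightarrow> l \<bullet> d + 0 * (l \<bullet> w) - 0\<^sup>2 * (l \<bullet> a)"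
    by (intro tendsto_intros hr le)
  moreover have "(\<lambda>k. - c * t (r k)) \<longlonglongrightarrow> - c * 1" by (intro tendsto_intros tr)
  ultimately have "l \<bullet> d + 0 * (l \<bullet> w) - 0\<^sup>2 * (l \<bullet> a) \<le> - c * 1"
    by (rule LIMSEQ_le) (use e(2) less_imp_le in blast)
  then have ld: "l \<bullet> d = - c" using sdual_inner_ge[OF l d] by simp
  \<comment> \<open>As \<open>e k \<bullet> d\<close> is at least \<open>- c\<close>, the leading
    terms cancel. What remains is of second order in \<open>h k\<close>, so division by
    \<open>h k\<close> leaves a bound tending to 0.\<close>
  have bound: "e k \<bullet> w \<le> - c * (h k + h k ^ 3) + h k" for k
  proof -
    have "t k \<le> 1 + ((h k)\<^sup>2 + (h k)^4)"
    proof -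
      have "1 + u \<le> (1 + u)\<^sup>2" if "0 \<le> u" for u :: real
        using that by (simp add: power2_eq_square algebra_simps)
      then have "1 + ((h k)\<^sup>2 + (h k)^4) \<le> (1 + ((h k)\<^sup>2 + (h k)^4))\<^sup>2" by simp
      then show ?thesis unfolding t_def by (intro real_le_lsqrt) (simp_all add: add.assoc)
    qed
    then have "- c * t k \<le> - c * (1 + ((h k)\<^sup>2 + (h k)^4))" using c0 by (intro mult_left_mono) auto
    moreover have "- c \<le> e k \<bullet> d" using sdual_inner_ge[OF e(1) d] .
    moreover have "(h k)\<^sup>2 * (e k \<bullet> a) \<le> (h k)\<^sup>2 * 1"
      using S2_inner_le_1(1)[OF sdual_S2[OF e(1)] S(2)] by (intro mult_left_mono) auto
    ultimately have "h k * (e k \<bullet> w) \<le> - c * ((h k)\<^sup>2 + (h k)^4) + (h k)\<^sup>2"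
      using e(2)[of k] by (simp add: algebra_simps)
    also have "\<dots> = h k * (- c * (h k + h k ^ 3) + h k)"
      by (simp add: power2_eq_square power3_eq_cube power4_eq_xxxx algebra_simps)
    finally show ?thesis using h0[of k] by simp
  qed
  have "(\<lambda>k. e (r k) \<bullet> w) \<longlonglongrightarrow> l \<bullet> w" by (intro tendsto_intros le)
  moreover have "(\<lambda>k. - c * (h (r k) + h (r k) ^ 3) + h (r k)) \<longlonglongrightarrow> - c * (0 + 0 ^ 3) + 0"
    by (intro tendsto_intros hr)
  ultimately have "l \<bullet> w \<le> - c * (0 + 0 ^ 3) + 0"
    by (rule LIMSEQ_le) (use bound in blast)
  then have "w \<bullet> l \<le> 0" by (simp add: inner_commute)
  then show thesis using that l ld by blast
qed

text \<open>Far points of \<open>d\<close> on both sides of the great circle through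
  \<open>d\<close> and \<open>a\<close> give contact points \<open>x1\<close>, \<open>x2\<close> on
  the circle bounding \<open>hemi d\<close>, with \<open>a\<close> between them. The product bounds
  at \<open>x1\<close> and \<open>x2\<close> combine to one at \<open>a\<close>, and completeness
  does the rest.\<close>

lemma wide_opposite_center:
  assumes c0: "c \<le> 0" and d: "d \<in> sdual R" and a: "a \<in> R" "d \<bullet> a = 0"
  shows "s *\<^sub>R a - c *\<^sub>R d \<in> sdual R"
proof -
  have S: "d \<in> S2" "a \<in> S2" using d a sdual_S2 R_S2 by blast+
  have da: "a \<bullet> d = 0" using a(2) by (simp add: inner_commute)
  define w where "w = cross3 d a"
  have w: "w \<in> S2" "d \<bullet> w = 0" "a \<bullet> w = 0" using cross3_frame[OF S a(2)] by (auto simp: w_def)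
  have w': "w \<bullet> d = 0" "w \<bullet> a = 0" using w by (simp_all add: inner_commute)
  obtain e1 where e1: "e1 \<in> sdual R" "e1 \<bullet> d = - c" "w \<bullet> e1 \<le> 0"
    using wide_far_point[OF c0 d a w(1) w'] by blast
  obtain e2 where e2: "e2 \<in> sdual R" "e2 \<bullet> d = - c" "(- w) \<bullet> e2 \<le> 0"
    using wide_far_point[OF c0 d a minus_S2[OF w(1)]] w' by auto
  define x1 x2 where "x1 = (1 / s) *\<^sub>R (e1 + c *\<^sub>R d)" and "x2 = (1 / s) *\<^sub>R (e2 + c *\<^sub>R d)"
  have x: "x1 \<in> R" "x2 \<in> R"
    using center_mem[OF e1(1) d e1(2)] center_mem[OF e2(1) d e2(2)] by (simp_all add: x1_def x2_def)
  have xd: "x1 \<bullet> d = 0" "x2 \<bullet> d = 0"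
    using e1(2) e2(2) S2_inner_self[OF S(1)] by (simp_all add: x1_def x2_def inner_add_left)
  have xw: "x1 \<bullet> w \<le> 0" "0 \<le> x2 \<bullet> w"
    using e1(3) e2(3) w(2) s_pos
    by (simp_all add: x1_def x2_def inner_add_left inner_add_right inner_commute divide_le_0_iff)
  have expand: "x = (x \<bullet> a) *\<^sub>R a + (x \<bullet> w) *\<^sub>R w" if "x \<bullet> d = 0" for x
    using orthonormal_expand(1)[OF S(1,2) w(1) a(2) w(2,3), of x] that by simp
  obtain f where f: "\<And>x. x \<in> R \<Longrightarrow> 0 < f \<bullet> x" using positive_functional by blast
  have "\<exists>\<alpha> \<beta>. 0 \<le> \<alpha> \<and> 0 \<le> \<beta> \<and> a = \<alpha> *\<^sub>R x1 + \<beta> *\<^sub>R x2"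
  proof (cases "x1 \<bullet> w = 0")
    case True
    then have x1a: "x1 = (x1 \<bullet> a) *\<^sub>R a" using expand[OF xd(1)] by simp
    then have "f \<bullet> x1 = (x1 \<bullet> a) * (f \<bullet> a)" by (metis inner_scaleR_right)
    then have pos: "0 < x1 \<bullet> a" using f[OF x(1)] f[OF a(1)] by (simp add: zero_less_mult_iff)
    have "a = sgn x1"
    proof -
      have "sgn x1 = sgn ((x1 \<bullet> a) *\<^sub>R a)" using x1a by simp
      also have "\<dots> = a" using pos S2_sgn[OF S(2)] by (simp add: sgn_scaleR)
      finally show ?thesis by simp
    qed
    then have "a = x1" using S2_sgn[OF R_S2[OF x(1)]] by simp
    then show ?thesis by (intro exI[of _ 1] exI[of _ 0]) simp
  next
    case False
    let ?g1 = "- (x1 \<bullet> w)" and ?g2 = "x2 \<bullet> w"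
    have g: "0 < ?g1" "0 \<le> ?g2" using xw False by auto
    \<comment> \<open>The weights cancel the components along \<open>w\<close>, so a multiple of
      \<open>a\<close> remains; the functional \<open>f\<close>, positive on \<open>R\<close>, shows
      that the factor is positive.\<close>
    define \<kappa> where "\<kappa> = ?g2 * (x1 \<bullet> a) + ?g1 * (x2 \<bullet> a)"
    have "?g2 *\<^sub>R x1 + ?g1 *\<^sub>R x2 =
        ?g2 *\<^sub>R ((x1 \<bullet> a) *\<^sub>R a + (x1 \<bullet> w) *\<^sub>R w) + ?g1 *\<^sub>R ((x2 \<bullet> a) *\<^sub>R a + (x2 \<bullet> w) *\<^sub>R w)"
      using expand[OF xd(1)] expand[OF xd(2)] by metis
    then have y: "?g2 *\<^sub>R x1 + ?g1 *\<^sub>R x2 = \<kappa> *\<^sub>R a"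
      by (simp add: \<kappa>_def algebra_simps)
    have "0 < ?g2 * (f \<bullet> x1) + ?g1 * (f \<bullet> x2)"
      using g f[OF x(1)] f[OF x(2)] by (intro add_nonneg_pos mult_pos_pos mult_nonneg_nonneg) auto
    also have "\<dots> = f \<bullet> (?g2 *\<^sub>R x1 + ?g1 *\<^sub>R x2)" by (simp add: inner_add_right inner_diff_right)
    also have "\<dots> = \<kappa> * (f \<bullet> a)" unfolding y by simp
    finally have k: "0 < \<kappa>" using f[OF a(1)] by (simp add: zero_less_mult_iff)
    have "a = (1 / \<kappa>) *\<^sub>R (\<kappa> *\<^sub>R a)" using k by simp
    also have "\<dots> = (?g2 / \<kappa>) *\<^sub>R x1 + (?g1 / \<kappa>) *\<^sub>R x2"
      unfolding y[symmetric] by (simp add: scaleR_add_right scaleR_diff_right)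
    finally have "a = (?g2 / \<kappa>) *\<^sub>R x1 + (?g1 / \<kappa>) *\<^sub>R x2" .
    moreover have "0 \<le> ?g2 / \<kappa>" "0 \<le> ?g1 / \<kappa>"
      using k g by (intro divide_nonneg_pos; simp)+
    ultimately show ?thesis by blast
  qed
  then obtain \<alpha> \<beta> where lm: "0 \<le> \<alpha>" "0 \<le> \<beta>" "a = \<alpha> *\<^sub>R x1 + \<beta> *\<^sub>R x2" by blast
  \<comment> \<open>All three vectors are unit, so the coefficients sum to at least 1; this is
    enough because the bound to be multiplied is nonnegative.\<close>
  have "norm a \<le> norm (\<alpha> *\<^sub>R x1) + norm (\<beta> *\<^sub>R x2)" unfolding lm(3) by (rule norm_triangle_ineq)
  then have one: "1 \<le> \<alpha> + \<beta>" using S(2) R_S2[OF x(1)] R_S2[OF x(2)] lm by simp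
  show ?thesis
  proof (rule complete[OF c0])
    have "(s *\<^sub>R a - c *\<^sub>R d) \<bullet> (s *\<^sub>R a - c *\<^sub>R d) = 1"
      using S[THEN S2_inner_self] a(2) da c2_s2 by (simp add: inner_diff_left inner_diff_right)
    then show "s *\<^sub>R a - c *\<^sub>R d \<in> S2" by (rule S2_I)
    fix y assume y: "y \<in> sdual R"
    have yd: "y \<bullet> d \<le> 1" using S2_inner_le_1(1)[OF sdual_S2[OF y] S(1)] .
    have key: "- c * (1 - y \<bullet> d) \<le> s * (y \<bullet> ((1 / s) *\<^sub>R (e + c *\<^sub>R d)))" if "e \<in> sdual R" for e
      using sdual_inner_ge[OF y that] s_pos by (simp add: inner_add_right algebra_simps)
    have A: "0 \<le> - c * (1 - y \<bullet> d)" using c0 yd by (simp add: mult_nonpos_nonneg)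
    have "- c * (1 - y \<bullet> d) \<le> (\<alpha> + \<beta>) * (- c * (1 - y \<bullet> d))"
      using mult_right_mono[OF one A] by simp
    also have "\<dots> = \<alpha> * (- c * (1 - y \<bullet> d)) + \<beta> * (- c * (1 - y \<bullet> d))" by (rule distrib_right)
    also have "\<dots> \<le> \<alpha> * (s * (y \<bullet> x1)) + \<beta> * (s * (y \<bullet> x2))"
      using key[OF e1(1)] key[OF e2(1)] lm unfolding x1_def x2_def by (intro add_mono mult_left_mono) auto
    also have "\<dots> = s * (y \<bullet> a)" unfolding lm(3) by (simp add: inner_add_right algebra_simps)
    finally show "- c \<le> y \<bullet> (s *\<^sub>R a - c *\<^sub>R d)" by (simp add: inner_diff_right algebra_simps)
  qed
qed

section \<open>Diametral pairs and the diameter\<close>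

lemma closest_to_antipodal:
  obtains a b where "a \<in> R" "b \<in> R" "\<forall>x\<in>R. \<forall>y\<in>R. a \<bullet> b \<le> x \<bullet> y"
proof -
  have "compact (R \<times> R)" by (intro compact_Times sconvex_body_compact[OF body])
  moreover have "R \<times> R \<noteq> {}" using R_not_singleton by blast
  moreover have "continuous_on (R \<times> R) (\<lambda>x. fst x \<bullet> snd x)" by (intro continuous_intros)
  ultimately have "\<exists>x\<in>R \<times> R. \<forall>y\<in>R \<times> R. fst x \<bullet> snd x \<le> fst y \<bullet> snd y"
    by (rule continuous_attains_inf)
  then obtain p where p: "p \<in> R \<times> R" "\<forall>y\<in>R \<times> R. fst p \<bullet> snd p \<le> fst y \<bullet> snd y" by (rule bexE)
  have "\<forall>x\<in>R. \<forall>y\<in>R. fst p \<bullet> snd p \<le> x \<bullet> y"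
    using bspec[OF p(2), of "(x, y)" for x y] by simp
  moreover have "fst p \<in> R" "snd p \<in> R" using p(1) by auto
  ultimately show thesis using that by blast
qed

lemma sdiam_eq:
  assumes "a \<in> R" "b \<in> R" "\<forall>x\<in>R. \<forall>y\<in>R. a \<bullet> b \<le> x \<bullet> y"
  shows "sdiam R = arccos (a \<bullet> b)"
  unfolding sdiam_def
proof (rule cSup_eq_maximum)
  show "arccos (a \<bullet> b) \<in> (\<lambda>(a, b). sdist a b) ` (R \<times> R)"
    using assms by (force simp: sdist_def)
  fix x assume "x \<in> (\<lambda>(a, b). sdist a b) ` (R \<times> R)"
  then obtain y z where "y \<in> R" "z \<in> R" "x = arccos (y \<bullet> z)" by (auto simp: sdist_def)
  then show "x \<le> arccos (a \<bullet> b)"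
    using assms S2_abs_inner[OF R_S2 R_S2, of y z] S2_abs_inner[OF R_S2 R_S2, of a b]
    by (simp add: arccos_le_mono)
qed

text \<open>For a diametral pair \<open>a\<close>, \<open>b\<close> the projection of
  \<open>b\<close> gives a hemisphere \<open>d\<close> supporting \<open>R\<close> at
  \<open>a\<close>. The opposite hemisphere of the thinnest lune at \<open>a\<close> must contain
  \<open>b\<close>, which fails if \<open>a \<bullet> b < c\<close>.\<close>

lemma wide_inner_ge:
  assumes c0: "c \<le> 0" and x: "x \<in> R" "y \<in> R"
  shows "c \<le> x \<bullet> y"
proof (rule ccontr)
  assume neg: "\<not> c \<le> x \<bullet> y"
  obtain a b where ab: "a \<in> R" "b \<in> R" and min: "\<forall>x\<in>R. \<forall>y\<in>R. a \<bullet> b \<le> x \<bullet> y"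
    by (rule closest_to_antipodal)
  let ?k = "a \<bullet> b"
  have kc: "?k < c" using bspec[OF bspec[OF min x(1)] x(2)] neg by simp
  have S: "a \<in> S2" "b \<in> S2" using ab R_S2 by blast+
  have "?k \<noteq> 1" using kc c0 by simp
  moreover have "b \<noteq> - a" using ab body by (auto simp: sconvex_body_def sconvex_def)
  ultimately have ne: "a \<noteq> b" "a \<noteq> - b" using S2_inner_eq_1[OF S] by auto
  define t where "t = sqrt (1 - ?k\<^sup>2)"
  have nv: "norm (b - ?k *\<^sub>R a) = t" and "0 < 1 - ?k\<^sup>2"
    using lune_center(2,3)[OF S ne] by (auto simp: t_def)
  then have t: "0 < t" "t\<^sup>2 = 1 - ?k\<^sup>2" by (simp_all add: t_def)
  define d where "d = sgn (b - ?k *\<^sub>R a)"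
  have RR: "R = sdual (sdual R)" using sdual_sdual[OF body] by simp
  have dD: "d \<in> sdual R"
  proof -
    \<comment> \<open>The first-order condition is used with \<open>R\<close> and its dual
      exchanged: \<open>a\<close> minimizes the product with \<open>b\<close> over \<open>R\<close>,
      the dual of \<open>sdual R\<close>.\<close>
    have "0 \<le> (b - (b \<bullet> a) *\<^sub>R a) \<bullet> z" if "z \<in> R" for z
    proof (rule sdual_minimizer_center[where C = "sdual R"])
      show "a \<in> sdual (sdual R)" "z \<in> sdual (sdual R)" using ab(1) that RR by auto
      show "b \<in> S2" by (rule S(2))
      show "b \<bullet> a \<le> b \<bullet> z'" if "z' \<in> sdual (sdual R)" for z'
        using min ab that RR by (auto simp: inner_commute)
    qed
    moreover have "d \<in> S2" unfolding d_def using nv t by (intro sgn_S2) auto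
    ultimately show ?thesis
      by (simp add: sdual_def d_def inner_sgn_nonneg_left inner_commute[of b a] del: mem_sphere_0)
  qed
  have da: "d \<bullet> a = 0"
    using S2_inner_self[OF S(1)] by (simp add: d_def inner_commute inner_sgn_right inner_diff_right)
  have "b \<bullet> (b - ?k *\<^sub>R a) = t\<^sup>2"
    using S2_inner_self[OF S(2)] t by (simp add: inner_diff_right inner_commute power2_eq_square)
  then have "b \<bullet> d = t\<^sup>2 / t" by (simp add: d_def inner_sgn_right nv)
  then have bd: "b \<bullet> d = t" using t(1) by (simp add: power2_eq_square)
  have "0 \<le> (s *\<^sub>R a - c *\<^sub>R d) \<bullet> b"
    using sdualD[OF wide_opposite_center[OF c0 dD ab(1) da] ab(2)] .
  then have "c * t \<le> s * ?k" using bd by (simp add: inner_diff_left inner_diff_right inner_commute)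
  \<comment> \<open>Both sides are nonnegative, so squaring is allowed and leaves
    \<open>?k\<^sup>2 \<le> c\<^sup>2\<close>, impossible for \<open>?k < c \<le> 0\<close>.\<close>
  then have "s * (- ?k) \<le> (- c) * t" by simp
  moreover have "0 \<le> s * (- ?k)" using s_pos kc c0 by (intro mult_nonneg_nonneg) auto
  ultimately have "(s * (- ?k))\<^sup>2 \<le> ((- c) * t)\<^sup>2" by (rule power_mono)
  then have "s\<^sup>2 * ?k\<^sup>2 \<le> c\<^sup>2 * (1 - ?k\<^sup>2)" using t by (simp add: power_mult_distrib)
  then have "(c\<^sup>2 + s\<^sup>2) * ?k\<^sup>2 \<le> c\<^sup>2" by (simp add: algebra_simps)
  then have "?k\<^sup>2 \<le> c\<^sup>2" using c2_s2 by (simp add: power2_eq_square)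
  then have "\<bar>?k\<bar> \<le> \<bar>c\<bar>" by (simp add: abs_le_square_iff)
  then show False using kc c0 by simp
qed

lemma E_nonempty: "E \<noteq> {}"
  using hull_E R_not_singleton by fastforce

text \<open>The two side centers of a thinnest lune lie in \<open>R\<close> and have product
  \<open>c\<close>, so the lower bound for products is attained.\<close>

lemma wide_sdiam:
  assumes c0: "c \<le> 0" shows "sdiam R = thickness R"
proof -
  obtain e where e: "e \<in> E" using E_nonempty by blast
  then obtain m where m: "m \<in> sdual R" "m \<bullet> e = 0" "s *\<^sub>R e - c *\<^sub>R m \<in> sdual R"
    by (auto simp: E_def)
  have eR: "e \<in> R" using e E_subset by blast
  have "m \<bullet> (s *\<^sub>R e - c *\<^sub>R m) = - c"
    using m S2_inner_self[OF sdual_S2[OF m(1)]] by (simp add: inner_diff_right)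
  then have q: "(1 / s) *\<^sub>R (m + c *\<^sub>R (s *\<^sub>R e - c *\<^sub>R m)) \<in> R" (is "?q \<in> R") using center_mem m by blast
  have "e \<bullet> ?q = c"
    using m(2) s_pos S2_inner_self[OF R_S2[OF eR]]
    by (simp add: inner_add_right inner_diff_right inner_commute)
  then have "sdiam R = arccos c"
    using sdiam_eq[OF eR q] wide_inner_ge[OF c0] by simp
  then show ?thesis using thickness_arccos by simp
qed

section \<open>The diameter for thickness below a right angle\<close>

lemma narrow_inner_ge: "0 < c \<Longrightarrow> x \<in> R \<Longrightarrow> y \<in> R \<Longrightarrow> c\<^sup>2 \<le> x \<bullet> y"
  using R_inner_ge[of "c\<^sup>2" x y] E_inner_ge by (simp add: power2_eq_square)

lemma narrow_sdiam_le:
  assumes "0 < c" shows "sdiam R \<le> arccos (c\<^sup>2)"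
proof -
  obtain a b where ab: "a \<in> R" "b \<in> R" and min: "\<forall>x\<in>R. \<forall>y\<in>R. a \<bullet> b \<le> x \<bullet> y"
    by (rule closest_to_antipodal)
  have "\<bar>c\<^sup>2\<bar> \<le> 1" using c_bounds by (simp add: abs_square_le_1)
  then have "arccos (a \<bullet> b) \<le> arccos (c\<^sup>2)"
    using narrow_inner_ge[OF assms ab] S2_abs_inner[OF R_S2 R_S2, OF ab] by (simp add: arccos_le_mono)
  then show ?thesis using sdiam_eq[OF ab min] by simp
qed

text \<open>The diametral pair need not be known to lie in \<open>E\<close>. But the least product
  over \<open>E\<close> bounds all products in \<open>R\<close> from below, so some pair in
  \<open>E\<close> attains \<open>c\<^sup>2\<close>, and \<open>quarter\<close> applies to
  it.\<close>

lemma narrow_sdiam_eq_imp_quarter: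
  assumes c0: "0 < c" and eq: "sdiam R = arccos (c\<^sup>2)"
  shows "quarter_of_disk (thickness R) R"
proof -
  obtain a b where ab: "a \<in> R" "b \<in> R" and min: "\<forall>x\<in>R. \<forall>y\<in>R. a \<bullet> b \<le> x \<bullet> y"
    by (rule closest_to_antipodal)
  have "\<bar>c\<^sup>2\<bar> \<le> 1" using c_bounds by (simp add: abs_square_le_1)
  then have k: "a \<bullet> b = c\<^sup>2"
    using eq sdiam_eq[OF ab min] S2_abs_inner[OF R_S2 R_S2, OF ab] by (simp add: arccos_eq_iff)
  have "compact (E \<times> E)" by (intro compact_Times compact_E)
  moreover have "E \<times> E \<noteq> {}" using E_nonempty by blast
  moreover have "continuous_on (E \<times> E) (\<lambda>x. fst x \<bullet> snd x)" by (intro continuous_intros)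
  ultimately have "\<exists>x\<in>E \<times> E. \<forall>y\<in>E \<times> E. fst x \<bullet> snd x \<le> fst y \<bullet> snd y"
    by (rule continuous_attains_inf)
  then obtain p where p: "p \<in> E \<times> E" "\<forall>y\<in>E \<times> E. fst p \<bullet> snd p \<le> fst y \<bullet> snd y" by (rule bexE)
  have pE: "fst p \<in> E" "snd p \<in> E" using p(1) by auto
  have ge: "c * c \<le> fst p \<bullet> snd p" using E_inner_ge[OF c0 pE] .
  have "fst p \<bullet> snd p \<le> a \<bullet> b"
  proof (rule R_inner_ge[OF _ _ ab])
    show "0 \<le> fst p \<bullet> snd p" using ge by (rule order_trans[rotated]) simp
    show "fst p \<bullet> snd p \<le> x \<bullet> y" if "x \<in> E" "y \<in> E" for x y
      using bspec[OF p(2), of "(x, y)"] that by simp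
  qed
  then have pp: "fst p \<bullet> snd p = c * c" using ge k by (simp add: power2_eq_square)
  obtain q u v where q: "q \<in> S2" "u \<in> S2" "v \<in> S2" "q \<bullet> u = 0" "q \<bullet> v = 0" "u \<bullet> v = 0"
    and R: "R = {x \<in> S2. c \<le> q \<bullet> x \<and> 0 \<le> x \<bullet> u \<and> 0 \<le> x \<bullet> v}"
    by (rule quarter[OF c0 pE pp])
  have th: "0 \<le> thickness R" "thickness R \<le> pi" using thickness_bounds by auto
  have half: "thickness R \<le> pi / 2"
    using thickness_arccos arccos_le_pi2[of c] c0 c_bounds by simp
  have "sdisk q (thickness R) = {x \<in> S2. c \<le> q \<bullet> x}"
    using sdisk_eq[OF q(1) th] by (simp only: c[symmetric])
  note disk = this
  have "R = {x \<in> sdisk q (thickness R). 0 \<le> x \<bullet> u \<and> 0 \<le> x \<bullet> v}"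
    unfolding disk mem_Collect_eq conj_assoc by (rule R)
  then show ?thesis unfolding quarter_of_disk_def using half thickness_bounds(1) q by blast
qed

text \<open>The outer ends of the two bounding radii have product \<open>c\<^sup>2\<close>, and the
  general bound shows that no pair is farther apart.\<close>

lemma quarter_imp_sdiam_eq:
  assumes c0: "0 < c" and Q: "quarter_of_disk (thickness R) R"
  shows "sdiam R = arccos (c\<^sup>2)"
proof -
  obtain q u v where q: "q \<in> S2" "u \<in> S2" "v \<in> S2" "q \<bullet> u = 0" "q \<bullet> v = 0" "u \<bullet> v = 0"
    and R: "R = {x \<in> sdisk q (thickness R). 0 \<le> x \<bullet> u \<and> 0 \<le> x \<bullet> v}"
    using Q unfolding quarter_of_disk_def by blast
  note sq = q(1-3)[THEN S2_inner_self]
  have q': "u \<bullet> q = 0" "v \<bullet> q = 0" "v \<bullet> u = 0" using q by (simp_all add: inner_commute)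
  have th: "0 \<le> thickness R" "thickness R \<le> pi" using thickness_bounds by auto
  have disk: "x \<in> R \<longleftrightarrow> x \<in> S2 \<and> c \<le> q \<bullet> x \<and> 0 \<le> x \<bullet> u \<and> 0 \<le> x \<bullet> v" for x
    using R sdisk_eq[OF q(1) th, folded c] by blast
  have "c *\<^sub>R q + s *\<^sub>R u \<in> S2" "c *\<^sub>R q + s *\<^sub>R v \<in> S2"
    by (rule S2_I, use sq q(4-6) q' c2_s2 in \<open>simp add: inner_add_left inner_add_right\<close>)+
  then have mem: "c *\<^sub>R q + s *\<^sub>R u \<in> R" "c *\<^sub>R q + s *\<^sub>R v \<in> R"
    unfolding disk using sq q(4-6) q' s_pos by (simp_all add: inner_add_left inner_add_right)
  have "(c *\<^sub>R q + s *\<^sub>R u) \<bullet> (c *\<^sub>R q + s *\<^sub>R v) = c\<^sup>2"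
    using sq q(4-6) q' by (simp add: inner_add_left inner_add_right power2_eq_square)
  then show ?thesis using sdiam_eq[OF mem] narrow_inner_ge[OF c0] by simp
qed

end

theorem theorem3p1:
  fixes R :: "(real^3) set"
  assumes "reduced_body R"
  shows "(thickness R < pi / 2 \<longrightarrow>
            sdiam R \<le> arccos ((cos (thickness R))\<^sup>2) \<and>
            (sdiam R = arccos ((cos (thickness R))\<^sup>2) \<longleftrightarrow> quarter_of_disk (thickness R) R)) \<and>
         (thickness R \<ge> pi / 2 \<longrightarrow> sdiam R = thickness R)"
proof -
  interpret reduced R "cos (thickness R)" "sin (thickness R)"
    by unfold_locales (use assms in simp_all)
  have "0 < cos (thickness R)" if "thickness R < pi / 2"
    using that thickness_bounds by (intro cos_gt_zero_pi) auto
  moreover have "cos (thickness R) \<le> 0" if "thickness R \<ge> pi / 2"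
    using that thickness_bounds cos_monotone_0_pi_le[of "pi / 2" "thickness R"] by simp
  ultimately show ?thesis
    using narrow_sdiam_le narrow_sdiam_eq_imp_quarter quarter_imp_sdiam_eq wide_sdiam by blast
qed

end
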